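(* Let $n\in\mathbb{N}$, $\alpha\in(0,1)$, $p\in\left(\frac{1}{1-\alpha},+\infty\right]$, and let $q\in[1,+\infty)$ with $\frac1p+\frac1q=1$. There exist constants $A_{n,\alpha,p},B_{n,\alpha,p}>0$, depending only on $n,\alpha,p$, such that: if $f\in BV^{\alpha,p}(\mathbb{R}^n)$, then for $|D^\alpha f|$-a.e. $x\in\mathbb{R}^n$ there exists $r_x>0$ such that $$|D^\alpha f|(B_r(x))\le A_{n,\alpha,p}\|f\|_{L^p(\mathbb{R}^n)}\,r^{\frac nq-\alpha}\quad\text{and}\quad|D^\alpha(f\chi_{B_r(x)})|(\mathbb{R}^n)\le B_{n,\alpha,p}\|f\|_{L^p(\mathbb{R}^n)}\,r^{\frac nq-\alpha}$$ for all $r\in(0,r_x)$.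
   Context: $B_r(x)$ is the open ball, $\chi_E$ the indicator of $E$. Let $\mu_{n,\alpha}=2^{\alpha}\pi^{-n/2}\Gamma\left(\frac{n+\alpha+1}{2}\right)/\Gamma\left(\frac{1-\alpha}{2}\right)$ and $\operatorname{div}^\alpha\varphi(x)=\mu_{n,\alpha}\int\frac{(y-x)\cdot(\varphi(y)-\varphi(x))}{|y-x|^{n+\alpha+1}}dy$ for $\varphi\in C^\infty_c(\mathbb{R}^n;\mathbb{R}^n)$. For $g\in L^1(\mathbb{R}^n)$ (or $L^p$), $|D^\alpha g|(\mathbb{R}^n):=\sup\{\int g\operatorname{div}^\alpha\varphi\,dx:\varphi\in C^\infty_c(\mathbb{R}^n;\mathbb{R}^n),\ \|\varphi\|_{L^\infty}\le1\}$, and $BV^{\alpha,p}(\mathbb{R}^n)$ is the set of $f\in L^p(\mathbb{R}^n)$ with $|D^\alpha f|(\mathbb{R}^n)<\infty$; for such $f$, $D^\alpha f$ is the unique finite $\mathbb{R}^n$-valued Radon measure with $\int f\operatorname{div}^\alpha\varphi=-\int\varphi\cdot dD^\alpha f$, and $|D^\alpha f|$ its total variation measure. *)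

theory Defs
  imports "HOL-Analysis.Analysis" "HOL-Probability.Essential_Supremum"
begin

coinductive smooth_map :: "('a::euclidean_space \<Rightarrow> 'b::euclidean_space) \<Rightarrow> bool" where
  "continuous_on UNIV f \<Longrightarrow> (\<forall>x. f differentiable (at x)) \<Longrightarrow>
   (\<forall>v. smooth_map (\<lambda>x. frechet_derivative f (at x) v)) \<Longrightarrow> smooth_map f"

definition test_field :: "('a::euclidean_space \<Rightarrow> 'a) \<Rightarrow> bool" where
  "test_field \<phi> \<longleftrightarrow> smooth_map \<phi> \<and> compact (closure {x. \<phi> x \<noteq> 0})"

definition mu_const :: "nat \<Rightarrow> real \<Rightarrow> real" where
  "mu_const n \<alpha> = (2::real) powr \<alpha> * pi powr (- real n / 2) *
     Gamma ((real n + \<alpha> + 1) / 2) / Gamma ((1 - \<alpha>) / 2)"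

definition frac_div :: "real \<Rightarrow> ('a::euclidean_space \<Rightarrow> 'a) \<Rightarrow> 'a \<Rightarrow> real" where
  "frac_div \<alpha> \<phi> x = mu_const DIM('a) \<alpha> *
     (\<integral> y. ((y - x) \<bullet> (\<phi> y - \<phi> x)) / norm (y - x) powr (real DIM('a) + \<alpha> + 1) \<partial>lebesgue)"

definition frac_var :: "real \<Rightarrow> ('a::euclidean_space \<Rightarrow> real) \<Rightarrow> ereal" where
  "frac_var \<alpha> g = (SUP \<phi> \<in> {\<phi>. test_field \<phi> \<and> (\<forall>x. norm (\<phi> x) \<le> 1)}.
       ereal (\<integral> x. g x * frac_div \<alpha> \<phi> x \<partial>lebesgue))"

definition in_Lp :: "ereal \<Rightarrow> ('a::euclidean_space \<Rightarrow> real) \<Rightarrow> bool" where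
  "in_Lp p f \<longleftrightarrow> f \<in> borel_measurable lebesgue \<and>
     (if p = \<infinity> then esssup lebesgue (\<lambda>x. ereal \<bar>f x\<bar>) < \<infinity>
      else integrable lebesgue (\<lambda>x. \<bar>f x\<bar> powr real_of_ereal p))"

definition Lp_norm :: "ereal \<Rightarrow> ('a::euclidean_space \<Rightarrow> real) \<Rightarrow> real" where
  "Lp_norm p f = (if p = \<infinity> then real_of_ereal (esssup lebesgue (\<lambda>x. ereal \<bar>f x\<bar>))
      else (\<integral> x. \<bar>f x\<bar> powr real_of_ereal p \<partial>lebesgue) powr (1 / real_of_ereal p))"

definition BV_frac :: "real \<Rightarrow> ereal \<Rightarrow> ('a::euclidean_space \<Rightarrow> real) \<Rightarrow> bool" where
  "BV_frac \<alpha> p f \<longleftrightarrow> in_Lp p f \<and> frac_var \<alpha> f < \<infinity>"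

text \<open>(mu, nu) is the polar decomposition of D^alpha f: mu = |D^alpha f| is a finite
  Borel measure on R^n, nu a Borel unit vector field, and D^alpha f = nu mu, i.e.
  the integration-by-parts identity holds for all test fields.\<close>
definition frac_grad_polar :: "real \<Rightarrow> ('a::euclidean_space \<Rightarrow> real) \<Rightarrow> 'a measure \<Rightarrow> ('a \<Rightarrow> 'a) \<Rightarrow> bool" where
  "frac_grad_polar \<alpha> f \<mu> \<nu> \<longleftrightarrow> sets \<mu> = sets borel \<and> finite_measure \<mu> \<and>
     \<nu> \<in> borel_measurable \<mu> \<and> (AE x in \<mu>. norm (\<nu> x) = 1) \<and>
     (\<forall>\<phi>. test_field \<phi> \<longrightarrow>
        (\<integral> x. f x * frac_div \<alpha> \<phi> x \<partial>lebesgue) = - (\<integral> x. \<phi> x \<bullet> \<nu> x \<partial>\<mu>))"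

end

theory Submission
  imports Defs
begin

text \<open>
  For a cutoff \<eta> one has div(\<eta> \<phi>) = \<eta> div \<phi> + T, where div is the fractional divergence and the
  commutator T is bounded by the potential D(x) = \<integral> |\<eta> y - \<eta> x| |y - x|^(-n-\<alpha>) dy. If \<eta> is the
  indicator of a ball of radius r then D has q-th power integral of order r^(n - \<alpha> q), since
  \<alpha> q < 1, so that Hoelder gives \<integral> |f| D \<le> C ||f|| r^(n/q - \<alpha>). Smooth radial cutoffs inherit this
  from their superlevel sets by the layer-cake formula and increase to the indicator of the ball.
  Integrating by parts, D f (the fractional gradient) has components of size r^(n/q - \<alpha>) on every
  ball, and the variation of f restricted to a ball exceeds |D f| of the ball by at most this order.

  It remains to pass from the vector measure D f = \<nu> \<mu> to \<mu> = |D f|: near a density point of the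
  set where \<nu> is close to a fixed vector e, the mass of a ball is at most twice the integral of
  e . \<nu>. Since \<mu> need not be doubling, such density points are only used at doubling radii.
\<close>

section \<open>Smooth cutoffs and test fields\<close>

text \<open>A smooth cutoff close to the indicator of a ball has a large gradient, so a Lipschitz
  bound on the commutator would blow up in the limit. The layer-cake bound does not see the
  gradient: each superlevel set is a concentric ball of radius at most r, and because n/q - \<alpha>
  is nonnegative the largest radius gives the worst bound. The estimate is therefore uniform in the
  steepness parameter \<open>k\<close>. The exponent n/q - \<alpha> is the q-th root of the order n
  - \<alpha> q. The growth argument is by contradiction: a violation at radius r is carried to a
  doubling radius R = 5^k r and refuted there. The growth factor 5^(2 n) per step has two duties. It
  dominates 5^(n/q - \<alpha>), so the violation survives the climb; and it beats the factor 5^n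
  allowed by the lower density bound, which forces R to be small with r. The reference vectors e run
  through a countable dense set, so that a single null set serves all of them; they are not unit
  vectors, which is paid for in the numerical constants.\<close>

primrec times_diff :: "nat \<Rightarrow> ('a::euclidean_space \<Rightarrow> 'b::euclidean_space) \<Rightarrow> bool" where
  "times_diff 0 f \<longleftrightarrow> continuous_on UNIV f"
| "times_diff (Suc k) f \<longleftrightarrow> (\<forall>x. f differentiable (at x)) \<and>
     (\<forall>v. times_diff k (\<lambda>x. frechet_derivative f (at x) v))"

lemma times_diff_SucI:
  assumes "\<And>x. (f has_derivative f' x) (at x)" and "\<And>v. times_diff k (\<lambda>x. f' x v)"
  shows "times_diff (Suc k) f"
proof -
  have "frechet_derivative f (at x) = f' x" for x
    using assms(1) frechet_derivative_at by metis
  then show ?thesis using assms by (auto simp: differentiable_def)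
qed

lemma times_diff_Suc_derivative:
  assumes "times_diff (Suc k) f"
  shows "(f has_derivative frechet_derivative f (at x)) (at x)"
  using assms by (simp flip: frechet_derivative_works)

text \<open>At positive order the definition asks only for differentiability and for regularity of
  the directional derivatives; continuity is recovered at the bottom from differentiability.\<close>

lemma times_diff_Suc_imp: "times_diff (Suc k) f \<Longrightarrow> times_diff k f"
proof (induction k arbitrary: f)
  case 0
  then show ?case
    by (auto intro!: continuous_at_imp_continuous_on differentiable_imp_continuous_within)
qed auto

text \<open>Replaces the coinductive predicate by a family indexed by the order, so that closure
  under sums, products and composition can be proved by induction. The backward direction is
  coinduction with the right-hand side as invariant.\<close>

lemma smooth_map_iff_times_diff: "smooth_map f \<longleftrightarrow> (\<forall>k. times_diff k f)"
proof
  have "times_diff k f" if "smooth_map f" for k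
    using that
  proof (induction k arbitrary: f)
    case 0
    then show ?case by (cases rule: smooth_map.cases) auto
  next
    case (Suc k)
    from Suc.prems show ?case by (cases rule: smooth_map.cases) (auto intro: Suc.IH)
  qed
  then show "smooth_map f \<Longrightarrow> \<forall>k. times_diff k f" by blast
next
  show "\<forall>k. times_diff k f \<Longrightarrow> smooth_map f"
  proof (coinduction arbitrary: f rule: smooth_map.coinduct)
    case smooth_map
    then have "times_diff 0 f" "\<And>k. times_diff (Suc k) f" by blast+
    then show ?case by auto
  qed
qed

lemma smooth_map_measurable: "smooth_map f \<Longrightarrow> f \<in> borel_measurable borel"
  using times_diff.simps(1)[of f]
  by (auto simp: smooth_map_iff_times_diff intro: borel_measurable_continuous_onI)

lemma times_diff_const: "times_diff k (\<lambda>x. c)"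
proof (induction k arbitrary: c)
  case (Suc k)
  show ?case by (rule times_diff_SucI[OF has_derivative_const]) (rule Suc)
qed auto

lemma times_diff_add: "times_diff k f \<Longrightarrow> times_diff k g \<Longrightarrow> times_diff k (\<lambda>x. f x + g x)"
proof (induction k arbitrary: f g)
  case (Suc k)
  show ?case
    by (rule times_diff_SucI[OF has_derivative_add])
      (use Suc in \<open>auto intro: times_diff_Suc_derivative simp flip: frechet_derivative_works\<close>)
qed (auto intro: continuous_on_add)

lemma times_diff_scaleR:
  "times_diff k u \<Longrightarrow> times_diff k g \<Longrightarrow> times_diff k (\<lambda>x. u x *\<^sub>R g x)"
proof (induction k arbitrary: u g)
  case (Suc k)
  note d = times_diff_Suc_derivative[OF Suc.prems(1)] times_diff_Suc_derivative[OF Suc.prems(2)]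
  show ?case
    by (rule times_diff_SucI[OF has_derivative_scaleR[OF d]], rule times_diff_add; rule Suc.IH)
      (use Suc.prems times_diff_Suc_imp in auto)
qed (auto intro: continuous_on_scaleR)

text \<open>By linearity of the derivative of a function of one real variable, the chain rule
  becomes a scalar product of the derivative of \<open>u\<close> with G' composed with
  \<open>u\<close>. The induction hypothesis applies to the latter and the product rule does the
  rest.\<close>

lemma times_diff_compose:
  fixes G :: "real \<Rightarrow> real"
  shows "times_diff k G \<Longrightarrow> times_diff k u \<Longrightarrow> times_diff k (\<lambda>x. G (u x))"
proof (induction k arbitrary: G u)
  case 0
  then show ?case by (auto intro: continuous_on_compose2)
next
  case (Suc k)
  note dG = times_diff_Suc_derivative[OF Suc.prems(1)]
  note du = times_diff_Suc_derivative[OF Suc.prems(2)]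
  have "((\<lambda>x. G (u x)) has_derivative
        (\<lambda>v. frechet_derivative u (at x) v *\<^sub>R frechet_derivative G (at (u x)) 1)) (at x)" for x
  proof -
    have lin: "linear (frechet_derivative G (at (u x)))"
      using dG has_derivative_linear by blast
    have "frechet_derivative G (at (u x)) (frechet_derivative u (at x) v)
        = frechet_derivative u (at x) v *\<^sub>R frechet_derivative G (at (u x)) 1" for v
      using linear_cmul[OF lin, of "frechet_derivative u (at x) v" 1] by simp
    moreover have "((\<lambda>x. G (u x)) has_derivative
        (\<lambda>v. frechet_derivative G (at (u x)) (frechet_derivative u (at x) v))) (at x)"
      using has_derivative_compose[OF du dG] .
    ultimately show ?thesis by simp
  qed
  then show ?case
  proof (rule times_diff_SucI)
    fix v
    have "times_diff k (\<lambda>x. frechet_derivative G (at (u x)) 1)"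
      by (rule Suc.IH[of "\<lambda>y. frechet_derivative G (at y) 1"])
        (use Suc.prems times_diff_Suc_imp in auto)
    then show "times_diff k (\<lambda>x. frechet_derivative u (at x) v *\<^sub>R frechet_derivative G (at (u x)) 1)"
      using Suc.prems(2) by (intro times_diff_scaleR) auto
  qed
qed

lemma times_diff_inner: "times_diff k (\<lambda>x. (x - c) \<bullet> w)"
proof (cases k)
  case (Suc m)
  have "((\<lambda>x. (x - c) \<bullet> w) has_derivative (\<lambda>v. v \<bullet> w)) (at x)" for x
    by (auto intro!: derivative_eq_intros)
  then show ?thesis unfolding Suc by (rule times_diff_SucI) (rule times_diff_const)
qed (auto intro!: continuous_intros)

lemma times_diff_dist_squared: "times_diff k (\<lambda>x. (x - c) \<bullet> (x - c))"
proof (cases k)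
  case (Suc m)
  have "((\<lambda>x. (x - c) \<bullet> (x - c)) has_derivative (\<lambda>v. 2 *\<^sub>R ((x - c) \<bullet> v))) (at x)" for x
    by (auto intro!: derivative_eq_intros simp: inner_commute)
  then show ?thesis unfolding Suc
    by (rule times_diff_SucI) (intro times_diff_scaleR times_diff_const times_diff_inner)
qed (auto intro!: continuous_intros)

section \<open>Radial cutoffs built from exp (-1/t)\<close>

definition flat_exp :: "nat \<Rightarrow> real \<Rightarrow> real" where
  "flat_exp j t = (if t > 0 then (1 / t) ^ j * exp (- (1 / t)) else 0)"

lemma flat_exp_tendsto_0: "(flat_exp j \<longlongrightarrow> 0) (at 0)"
proof -
  have "((\<lambda>t::real. (1 / t) ^ j / exp (1 / t)) \<longlongrightarrow> 0) (at_right 0)"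
    using filterlim_compose[OF tendsto_power_div_exp_0 filterlim_inverse_at_top_right]
    by (simp add: divide_inverse)
  then have "(flat_exp j \<longlongrightarrow> 0) (at_right 0)"
  proof (rule Lim_transform_eventually)
    show "\<forall>\<^sub>F t in at_right 0. (1 / t) ^ j / exp (1 / t) = flat_exp j t"
      unfolding eventually_at_right_field
      by (intro exI[of _ 1]) (auto simp: flat_exp_def exp_minus divide_inverse)
  qed
  moreover have "(flat_exp j \<longlongrightarrow> 0) (at_left 0)"
  proof (rule Lim_transform_eventually[OF tendsto_const])
    show "\<forall>\<^sub>F t in at_left 0. 0 = flat_exp j t"
      unfolding eventually_at_left_field
      by (intro exI[of _ "-1"]) (auto simp: flat_exp_def)
  qed
  ultimately show ?thesis by (simp add: filterlim_split_at)
qed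

text \<open>The family is closed under differentiation up to linear combinations. This is why all
  powers \<open>j\<close> are carried along, although the cutoffs use only
  \<open>j = 0\<close>.\<close>

lemma flat_exp_derivative:
  "(flat_exp j has_real_derivative flat_exp (j + 2) t - real j * flat_exp (j + 1) t) (at t)"
proof (cases t "0::real" rule: linorder_cases)
  case less
  have "((\<lambda>_. 0) has_real_derivative 0) (at t)" by simp
  moreover have "\<forall>\<^sub>F x in nhds t. flat_exp j x = 0"
    using eventually_nhds_in_open[of "{..<0}" t] less
    by (auto simp: flat_exp_def elim: eventually_mono)
  ultimately have "(flat_exp j has_real_derivative 0) (at t)"
    by (subst DERIV_cong_ev[OF refl _ refl, of _ "\<lambda>_. 0"]) auto
  then show ?thesis using less by (simp add: flat_exp_def)
next
  case equal
  \<comment> \<open>The difference quotient at 0 is exactly \<open>flat_exp (j + 1)\<close>, so the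
    limit at 0 for the next index gives derivative 0.\<close>
  have "((\<lambda>h. (flat_exp j (0 + h) - flat_exp j 0) / h) \<longlongrightarrow> 0) (at 0)"
  proof (rule Lim_transform_eventually[OF flat_exp_tendsto_0[of "j+1"]])
    show "\<forall>\<^sub>F h in at 0. flat_exp (j + 1) h = (flat_exp j (0 + h) - flat_exp j 0) / h"
      by (auto simp: flat_exp_def)
  qed
  then show ?thesis using equal by (auto simp: DERIV_def flat_exp_def)
next
  case greater
  have "((\<lambda>t. (1 / t) ^ j * exp (- (1 / t))) has_real_derivative
      (1/t) ^ (j+2) * exp (- (1 / t)) - real j * ((1/t) ^ (j+1) * exp (- (1 / t)))) (at t)"
  proof -
    have inv: "((\<lambda>t. 1 / t) has_real_derivative - ((1 / t) * (1 / t))) (at t)"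
      using greater by (auto intro!: derivative_eq_intros)
    have "((\<lambda>t. (1 / t) ^ j * exp (- (1 / t))) has_real_derivative
        (- (real j * (1 / t) ^ (j + 1))) * exp (- (1 / t))
          + exp (- (1 / t)) * - (- ((1 / t) * (1 / t))) * (1 / t) ^ j) (at t)"
    proof (intro DERIV_mult DERIV_fun_exp DERIV_minus inv)
      show "((\<lambda>t. (1 / t) ^ j) has_real_derivative - (real j * (1 / t) ^ (j + 1))) (at t)"
        using DERIV_power[OF inv, of j] by (cases j) (simp_all add: mult_ac)
    qed
    then show ?thesis by (simp add: algebra_simps)
  qed
  moreover have "\<forall>\<^sub>F x in nhds t. flat_exp j x = (1 / x) ^ j * exp (- (1 / x))"
    using eventually_nhds_in_open[of "{0<..}" t] greater
    by (auto simp: flat_exp_def elim: eventually_mono)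
  ultimately show ?thesis using greater
    by (subst DERIV_cong_ev[OF refl _ refl]) (auto simp: flat_exp_def)
qed

lemma times_diff_flat_exp: "times_diff k (flat_exp j)"
proof (induction k arbitrary: j)
  case 0
  show ?case using flat_exp_derivative
    by (auto intro!: continuous_at_imp_continuous_on DERIV_isCont)
next
  case (Suc k)
  have "(flat_exp j has_derivative
    (\<lambda>v. v *\<^sub>R (flat_exp (j + 2) t + (- real j) *\<^sub>R flat_exp (j + 1) t))) (at t)" for t
    using flat_exp_derivative[of j t]
    by (simp add: has_field_derivative_def mult.commute[of _ "_ - _"])
  then show ?case
    by (rule times_diff_SucI) (intro times_diff_scaleR times_diff_add times_diff_const Suc)
qed

text \<open>The squared distance keeps the function smooth at the centre. Increasing
  \<open>k\<close> scales the argument of \<open>flat_exp 0\<close> up, which drives the value to 1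
  at every point of the open ball without moving the support out of it.\<close>

definition ball_cutoff :: "'a::euclidean_space \<Rightarrow> real \<Rightarrow> nat \<Rightarrow> 'a \<Rightarrow> real" where
  "ball_cutoff c r k y = flat_exp 0 (real k * (1 - ((y - c) \<bullet> (y - c)) / r\<^sup>2))"

lemma smooth_ball_cutoff: "smooth_map (ball_cutoff c r k)"
proof -
  have "times_diff m (\<lambda>y. flat_exp 0 (real k + (- real k / r\<^sup>2) *\<^sub>R ((y - c) \<bullet> (y - c))))" for m
    by (rule times_diff_compose, rule times_diff_flat_exp,
        intro times_diff_add times_diff_scaleR times_diff_const times_diff_dist_squared)
  then show ?thesis
    by (simp add: smooth_map_iff_times_diff ball_cutoff_def[abs_def] right_diff_distrib)
qed

lemma flat_exp_0_eq: "flat_exp 0 t = (if t > 0 then exp (- (1 / t)) else 0)"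
  by (simp add: flat_exp_def)

lemma ball_cutoff_bounds: "0 \<le> ball_cutoff c r k y" "ball_cutoff c r k y \<le> 1"
  by (auto simp: ball_cutoff_def flat_exp_0_eq)

lemma dist_less_iff_inner:
  fixes c y :: "'a::euclidean_space" assumes "r > 0"
  shows "1 - ((y - c) \<bullet> (y - c)) / r\<^sup>2 > 0 \<longleftrightarrow> y \<in> ball c r"
proof -
  have "(y - c) \<bullet> (y - c) < r\<^sup>2 \<longleftrightarrow> norm (y - c) < r"
    using assms by (simp add: dot_square_norm power2_less_imp_less abs_le_square_iff flip: not_le)
  then show ?thesis using assms by (simp add: dist_norm norm_minus_commute)
qed

lemma ball_cutoff_outside: "r > 0 \<Longrightarrow> y \<notin> ball c r \<Longrightarrow> ball_cutoff c r k y = 0"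
proof -
  assume "r > 0" "y \<notin> ball c r"
  then have "1 - ((y - c) \<bullet> (y - c)) / r\<^sup>2 \<le> 0"
    using dist_less_iff_inner[of r y c] by (meson not_le)
  then have "real k * (1 - ((y - c) \<bullet> (y - c)) / r\<^sup>2) \<le> 0"
    by (rule mult_nonneg_nonpos[OF of_nat_0_le_iff])
  then show ?thesis unfolding ball_cutoff_def flat_exp_0_eq by simp
qed

lemma ball_cutoff_le_indicator: "r > 0 \<Longrightarrow> ball_cutoff c r k y \<le> indicator (ball c r) y"
  using ball_cutoff_outside[of r y c k] ball_cutoff_bounds[of c r k y] by (auto simp: indicator_def)

lemma ball_cutoff_tendsto:
  assumes "r > 0"
  shows "(\<lambda>k. ball_cutoff c r k y) \<longlonglongrightarrow> indicator (ball c r) y"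
proof (cases "y \<in> ball c r")
  case True
  define d where "d = 1 - ((y - c) \<bullet> (y - c)) / r\<^sup>2"
  have d: "d > 0" using True dist_less_iff_inner[OF assms] d_def by blast
  have "(\<lambda>k. exp (- (1 / (real k * d)))) \<longlonglongrightarrow> exp 0"
  proof (intro tendsto_intros)
    have "(\<lambda>k. - (1 / d * (1 / real k))) \<longlonglongrightarrow> - (1 / d * 0)"
      by (intro tendsto_intros lim_1_over_n)
    then show "(\<lambda>k. - (1 / (real k * d))) \<longlonglongrightarrow> 0" by (simp add: field_simps)
  qed
  moreover have "\<forall>\<^sub>F k in sequentially. exp (- (1 / (real k * d))) = ball_cutoff c r k y"
    using eventually_gt_at_top[of 0]
    by eventually_elim (use d in \<open>auto simp: ball_cutoff_def flat_exp_0_eq d_def[symmetric]\<close>)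
  ultimately show ?thesis using True by (auto intro: Lim_transform_eventually)
next
  case False
  then show ?thesis using ball_cutoff_outside[OF assms False] by simp
qed

text \<open>The level t of flat_exp 0 is attained at 1 / l with l = - ln t.\<close>
lemma ball_cutoff_superlevel:
  assumes r: "r > 0" and t: "0 \<le> t" "t < 1"
  obtains s where "0 \<le> s" "s \<le> r" "{y. t < ball_cutoff c r k y} = ball c s"
proof (cases "t = 0 \<or> k = 0")
  case True
  show ?thesis
  proof (cases "k = 0")
    case True
    \<comment> \<open>For \<open>k = 0\<close> the cutoff vanishes identically, so the superlevel
      set is empty.\<close>
    then have "{y. t < ball_cutoff c r k y} = ball c 0" using t
      by (auto simp: ball_cutoff_def flat_exp_0_eq)
    then show ?thesis using that[of 0] r by auto
  next
    case False
    then have "t < flat_exp 0 (real k * d) \<longleftrightarrow> 0 < d" for d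
      using True by (simp add: flat_exp_0_eq zero_less_mult_iff)
    then have "{y. t < ball_cutoff c r k y} = ball c r"
      unfolding ball_cutoff_def using dist_less_iff_inner[OF r, of _ c] by blast
    then show ?thesis using that[of r] r by auto
  qed
next
  case False
  then have t0: "t > 0" and k: "k > 0" using t by auto
  define l where "l = - ln t"
  define u where "u = 1 / (l * real k)"
  have l: "l > 0" and t_eq: "t = exp (- l)" using t t0 by (simp_all add: l_def)
  have u: "u > 0" using l k by (simp add: u_def)
  have lev: "t < flat_exp 0 (real k * d) \<longleftrightarrow> u < d" for d
  proof (cases "d > 0")
    case True
    have "t < exp (- (1 / (real k * d))) \<longleftrightarrow> 1 / (real k * d) < l"
      by (simp add: t_eq)
    also have "\<dots> \<longleftrightarrow> u < d"
      using l k True by (simp add: u_def pos_divide_less_eq mult_ac)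
    finally show ?thesis using True k by (simp add: flat_exp_0_eq)
  next
    case False
    then have "real k * d \<le> 0" by (simp add: mult_nonneg_nonpos)
    then show ?thesis using False t0 u by (auto simp: flat_exp_0_eq)
  qed
  \<comment> \<open>The condition u < 1 - |y - c|^2 / r^2 solved for |y - c|. The truncation at 0
    yields the empty ball when the level is not reached.\<close>
  define s where "s = r * sqrt (max 0 (1 - u))"
  have "s \<le> r" "0 \<le> s" using r u by (auto simp: s_def mult_le_cancel_left1 max_def)
  moreover have "t < ball_cutoff c r k y \<longleftrightarrow> y \<in> ball c s" for y
  proof -
    have "t < ball_cutoff c r k y \<longleftrightarrow> (norm (y - c))\<^sup>2 < r\<^sup>2 * (1 - u)"
      unfolding ball_cutoff_def lev using r by (auto simp: field_simps dot_square_norm)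
    also have "\<dots> \<longleftrightarrow> (norm (y - c))\<^sup>2 < s\<^sup>2"
    proof (cases "1 - u \<ge> 0")
      case True
      then show ?thesis by (simp add: s_def power_mult_distrib)
    next
      case False
      then have "r\<^sup>2 * (1 - u) \<le> 0" using r by (simp add: mult_nonneg_nonpos)
      then have "\<not> (norm (y - c))\<^sup>2 < r\<^sup>2 * (1 - u)"
        by (meson dual_order.trans not_le zero_le_power2)
      then show ?thesis using False by (simp add: s_def max_def)
    qed
    also have "\<dots> \<longleftrightarrow> norm (y - c) < s"
      using \<open>0 \<le> s\<close> by (meson norm_ge_zero power_less_imp_less_base power_strict_mono zero_less_numeral)
    finally show ?thesis by (simp add: dist_norm norm_minus_commute)
  qed
  then have "{y. t < ball_cutoff c r k y} = ball c s" by blast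
  ultimately show ?thesis using that[of s] by blast
qed

section \<open>Cutoffs of test fields and global bounds\<close>

lemma test_field_cutoff:
  assumes "smooth_map u" and "test_field \<phi>"
  shows "test_field (\<lambda>x. u x *\<^sub>R \<phi> x)"
proof -
  have "smooth_map (\<lambda>x. u x *\<^sub>R \<phi> x)"
    using assms by (auto simp: test_field_def smooth_map_iff_times_diff intro: times_diff_scaleR)
  moreover have "closure {x. u x *\<^sub>R \<phi> x \<noteq> 0} \<subseteq> closure {x. \<phi> x \<noteq> 0}"
    by (intro closure_mono) auto
  then have "compact (closure {x. u x *\<^sub>R \<phi> x \<noteq> 0})"
    using assms(2) compact_Int_closed[of "closure {x. \<phi> x \<noteq> 0}" "closure {x. u x *\<^sub>R \<phi> x \<noteq> 0}"]
    by (simp add: test_field_def Int_absorb1)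
  ultimately show ?thesis by (simp add: test_field_def)
qed

lemma test_field_ball_cutoff_const:
  assumes "r > 0" shows "test_field (\<lambda>x. ball_cutoff c r k x *\<^sub>R e)"
proof -
  have "smooth_map (\<lambda>x. ball_cutoff c r k x *\<^sub>R e)"
    using smooth_ball_cutoff[of c r k]
    by (auto simp: smooth_map_iff_times_diff intro!: times_diff_scaleR times_diff_const)
  moreover have "{x. ball_cutoff c r k x *\<^sub>R e \<noteq> 0} \<subseteq> ball c r"
    using ball_cutoff_outside[OF assms, of _ c k] by force
  ultimately show ?thesis
    unfolding test_field_def by (meson bounded_ball bounded_subset compact_closure)
qed

lemma test_field_bounded:
  assumes "test_field \<phi>"
  obtains C where "C \<ge> 0" "\<And>x. norm (\<phi> x) \<le> C"
proof -
  have cont: "continuous_on UNIV \<phi>" and cpt: "compact (closure {x. \<phi> x \<noteq> 0})"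
    using assms smooth_map_iff_times_diff[of \<phi>] times_diff.simps(1)[of \<phi>] by (auto simp: test_field_def)
  have "bounded (\<phi> ` closure {x. \<phi> x \<noteq> 0})"
    using compact_continuous_image continuous_on_subset cont cpt compact_imp_bounded
    by (metis subset_UNIV)
  then obtain C where C: "\<And>x. x \<in> closure {x. \<phi> x \<noteq> 0} \<Longrightarrow> norm (\<phi> x) \<le> C" and "C > 0"
    unfolding bounded_pos by auto
  have "norm (\<phi> x) \<le> C" for x
    using C[of x] \<open>C > 0\<close> closure_subset[of "{x. \<phi> x \<noteq> 0}"] by (cases "\<phi> x = 0") auto
  then show ?thesis using that[of C] \<open>C > 0\<close> by auto
qed

text \<open>The derivative is bounded on the compact support and zero off it. The Lipschitz bound
  gains one power of |y - x| against the kernel, which makes the singularity integrable because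
  \<alpha> < 1.\<close>

lemma test_field_Lipschitz:
  assumes "test_field \<phi>"
  obtains C where "C \<ge> 0" "\<And>x y. norm (\<phi> y - \<phi> x) \<le> C * norm (y - x)"
proof -
  let ?K = "closure {x. \<phi> x \<noteq> 0}"
  let ?D = "\<lambda>x. frechet_derivative \<phi> (at x)"
  have td: "times_diff k \<phi>" for k
    using assms smooth_map_iff_times_diff[of \<phi>] by (auto simp: test_field_def)
  have cpt: "compact ?K" using assms by (auto simp: test_field_def)
  have der: "(\<phi> has_derivative ?D x) (at x)" for x
    using times_diff_Suc_derivative[OF td] .
  have cont: "continuous_on UNIV (\<lambda>x. ?D x b)" for b
    using td[of "Suc 0"] by auto
  have "\<exists>B>0. \<forall>x\<in>?K. norm (?D x b) \<le> B" for b
    using compact_continuous_image[OF continuous_on_subset[OF cont[of b]] cpt]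
      compact_imp_bounded bounded_pos by (metis (no_types, lifting) image_eqI subset_UNIV)
  then obtain B where B: "\<And>b. B b > 0" "\<And>b x. x \<in> ?K \<Longrightarrow> norm (?D x b) \<le> B b" by metis
  have zero: "?D x = (\<lambda>_. 0)" if "x \<notin> ?K" for x
  proof -
    have "(\<phi> has_derivative (\<lambda>_. 0)) (at x)"
    proof (rule has_derivative_transform_within_open[OF has_derivative_const])
      show "open (- ?K)" "x \<in> - ?K" using that by auto
      show "0 = \<phi> y" if "y \<in> - ?K" for y
        using that closure_subset[of "{x. \<phi> x \<noteq> 0}"] by auto
    qed
    then show ?thesis using frechet_derivative_at by metis
  qed
  have Bx: "norm (?D x b) \<le> B b" for x b
    using B zero[of x] less_imp_le[OF B(1)[of b]] by (cases "x \<in> ?K") auto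
  \<comment> \<open>Continuity is available only for each directional derivative, so the operator
    norm is estimated through the basis vectors.\<close>
  define C where "C = (\<Sum>b\<in>Basis. B b)"
  have C0: "C \<ge> 0" unfolding C_def using B(1) by (intro sum_nonneg) (simp add: less_imp_le)
  have "onorm (?D x) \<le> C" for x
  proof (rule onorm_bound[OF C0])
    fix v
    have lin: "linear (?D x)" using der has_derivative_linear by blast
    have "?D x v = ?D x (\<Sum>b\<in>Basis. (v \<bullet> b) *\<^sub>R b)" by (simp add: euclidean_representation)
    also have "\<dots> = (\<Sum>b\<in>Basis. (v \<bullet> b) *\<^sub>R ?D x b)"
      using lin by (simp add: linear_sum linear_cmul)
    finally have "norm (?D x v) \<le> (\<Sum>b\<in>Basis. norm ((v \<bullet> b) *\<^sub>R ?D x b))"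
      by (metis norm_sum)
    also have "\<dots> \<le> (\<Sum>b\<in>Basis. B b * norm v)"
      by (intro sum_mono)
        (use Bx Basis_le_norm in \<open>auto simp: mult.commute[of "B _"] intro!: mult_mono\<close>)
    finally show "norm (?D x v) \<le> C * norm v" by (simp add: C_def sum_distrib_right)
  qed
  then have "norm (\<phi> y - \<phi> x) \<le> C * norm (y - x)" for x y
    by (intro differentiable_bound[of UNIV \<phi> ?D]) (use der in auto)
  then show ?thesis using that[OF C0] by blast
qed

section \<open>Growth of the total variation of a vector measure\<close>

text \<open>Only measurable covers of the exceptional set are asked for, not its measurability:
  covering arguments deliver such covers directly.\<close>

lemma AE_I_small:
  assumes "\<And>\<epsilon>::real. \<epsilon> > 0 \<Longrightarrow> \<exists>T\<in>sets M. {x \<in> space M. \<not> P x} \<subseteq> T \<and> emeasure M T \<le> ennreal \<epsilon>"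
  shows "AE x in M. P x"
proof -
  have "\<exists>T\<in>sets M. {x \<in> space M. \<not> P x} \<subseteq> T \<and> emeasure M T \<le> ennreal (1 / Suc k)" for k
    by (rule assms) simp
  then obtain T where T: "\<And>k. T k \<in> sets M" "\<And>k. {x \<in> space M. \<not> P x} \<subseteq> T k"
    "\<And>k. emeasure M (T k) \<le> ennreal (1 / Suc k)"
    by metis
  have "emeasure M (\<Inter>k. T k) \<le> 0"
  proof (rule ennreal_le_epsilon)
    fix e :: real assume "0 < e"
    then obtain k where "1 / Suc k < e" using nat_approx_posE by blast
    have "emeasure M (\<Inter>k. T k) \<le> emeasure M (T k)" using T by (intro emeasure_mono) auto
    also have "\<dots> \<le> ennreal (1 / Suc k)" by (rule T)
    also have "\<dots> \<le> ennreal e" using \<open>1 / Suc k < e\<close> by (intro ennreal_leI) simp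
    finally show "emeasure M (\<Inter>k. T k) \<le> 0 + ennreal e" by simp
  qed
  then show ?thesis
    using T by (intro AE_I[of M P "\<Inter>k. T k"]) auto
qed

text \<open>The selected disjoint balls lie in \<open>V\<close> and add up to at most N(V), while
  their fivefold enlargements cover \<open>S\<close>. The comparison measure \<open>N\<close> is
  Lebesgue measure in the lower density bound and \<mu> restricted to a complement in the density
  theorem.\<close>

lemma Vitali_measure_bound:
  fixes \<rho> :: "'a::euclidean_space \<Rightarrow> real"
  assumes sets: "sets \<mu> = sets borel" "sets N = sets borel"
    and \<rho>: "\<And>x. x \<in> S \<Longrightarrow> 0 < \<rho> x \<and> \<rho> x \<le> 1"
    and le: "\<And>x. x \<in> S \<Longrightarrow> emeasure \<mu> (ball x (5 * \<rho> x)) \<le> K * emeasure N (ball x (\<rho> x))"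
    and V: "V \<in> sets borel" "\<And>x. x \<in> S \<Longrightarrow> ball x (\<rho> x) \<subseteq> V"
  shows "\<exists>T\<in>sets \<mu>. S \<subseteq> T \<and> emeasure \<mu> T \<le> K * emeasure N V"
proof -
  have "S \<subseteq> (\<Union>x\<in>S. ball x (\<rho> x))" using \<rho> by force
  from Vitali_covering_lemma_balls[where a="\<lambda>x. x", OF this \<rho>]
  obtain C where C: "countable C" "C \<subseteq> S"
     "pairwise (\<lambda>i j. disjnt (ball i (\<rho> i)) (ball j (\<rho> j))) C"
     "S \<subseteq> (\<Union>i\<in>C. ball i (5 * \<rho> i))" by auto
  define g where "g = inv_into C (to_nat_on C)"
  define I where "I = to_nat_on C ` C"
  have inj: "inj_on (to_nat_on C) C" by (rule inj_on_to_nat_on[OF C(1)])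
  have gC: "g k \<in> C" "to_nat_on C (g k) = k" if "k \<in> I" for k
    using that by (auto simp: g_def I_def inv_into_into f_inv_into_f)
  have gto: "g (to_nat_on C x) = x" "to_nat_on C x \<in> I" if "x \<in> C" for x
    using that inj by (auto simp: g_def I_def)
  define A where "A k = (if k \<in> I then ball (g k) (5 * \<rho> (g k)) else {})" for k
  define D where "D k = (if k \<in> I then ball (g k) (\<rho> (g k)) else {})" for k
  have mA: "range A \<subseteq> sets \<mu>" and mD: "range D \<subseteq> sets N" by (auto simp: A_def D_def sets)
  have disj: "disjoint_family D"
    unfolding disjoint_family_on_def
  proof (intro ballI impI)
    fix j k :: nat assume "j \<noteq> k"
    show "D j \<inter> D k = {}"
    proof (cases "j \<in> I \<and> k \<in> I")
      case True
      then have "g j \<noteq> g k" using gC \<open>j \<noteq> k\<close> by metis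
      then show ?thesis using C(3) gC True
        by (auto simp: D_def pairwise_def disjnt_def simp del: mem_ball)
    qed (auto simp: D_def)
  qed
  have "S \<subseteq> (\<Union>k. A k)"
  proof
    fix x assume "x \<in> S"
    then obtain i where "i \<in> C" "x \<in> ball i (5 * \<rho> i)" using C(4) by blast
    then have "x \<in> A (to_nat_on C i)" using gto by (simp add: A_def)
    then show "x \<in> (\<Union>k. A k)" by blast
  qed
  moreover have "emeasure \<mu> (\<Union>k. A k) \<le> K * emeasure N V"
  proof -
    have "emeasure \<mu> (\<Union>k. A k) \<le> (\<Sum>k. emeasure \<mu> (A k))"
      by (rule emeasure_subadditive_countably[OF mA])
    also have "\<dots> \<le> (\<Sum>k. K * emeasure N (D k))"
    proof (intro suminf_le)
      show "emeasure \<mu> (A k) \<le> K * emeasure N (D k)" for k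
        using gC(1)[of k] C(2) le[of "g k"] by (auto simp: A_def D_def)
    qed auto
    also have "\<dots> = K * emeasure N (\<Union>k. D k)"
      using suminf_emeasure[OF mD disj] by simp
    also have "\<dots> \<le> K * emeasure N V"
    proof (intro mult_left_mono emeasure_mono)
      show "(\<Union>k. D k) \<subseteq> V"
        using gC(1) C(2) V(2) by (auto simp: D_def simp del: mem_ball split: if_splits)
    qed (use V sets in auto)
    finally show ?thesis .
  qed
  moreover have "(\<Union>k. A k) \<in> sets \<mu>" using mA by auto
  ultimately show ?thesis by blast
qed

section \<open>Densities of a finite Borel measure at almost every point\<close>

locale finite_borel_measure = finite_measure \<mu> for \<mu> :: "'a::euclidean_space measure" +
  assumes sets_eq [measurable_cong]: "sets \<mu> = sets borel"
begin

lemma space_eq [simp]: "space \<mu> = UNIV"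
  using sets_eq_imp_space_eq[OF sets_eq] by simp

text \<open>A point without such a bound has balls whose mass is below any prescribed multiple of
  r^n, hence below a small multiple of the Lebesgue measure of the ball with radius r / 5. The
  covering lemma then makes the set of these points small for \<mu>.\<close>

lemma AE_lower_density:
  "AE x in \<mu>. \<exists>c>0. \<forall>r. 0 < r \<and> r < 1 \<longrightarrow> c * r ^ DIM('a) \<le> measure \<mu> (ball x r)"
proof -
  let ?n = "DIM('a)"
  let ?P = "\<lambda>x. \<exists>c>0. \<forall>r. 0 < r \<and> r < 1 \<longrightarrow> c * r ^ ?n \<le> measure \<mu> (ball x r)"
  \<comment> \<open>Localised so that the ball of radius m + 1, which contains all balls of the
    covering, has finite Lebesgue measure.\<close>
  have "AE x in \<mu>. x \<in> ball 0 (real m) \<longrightarrow> ?P x" for m :: nat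
  proof (rule AE_I_small)
    fix \<epsilon> :: real assume \<epsilon>: "\<epsilon> > 0"
    let ?S = "{x \<in> space \<mu>. \<not> (x \<in> ball 0 (real m) \<longrightarrow> ?P x)}"
    define w where "w = unit_ball_vol (real ?n)"
    define v where "v = w * (real m + 1) ^ ?n"
    have w: "w > 0" and v: "v > 0" by (auto simp: w_def v_def)
    \<comment> \<open>\<open>v\<close> is the volume of the enclosing ball, so K v = \<epsilon>;
      below, \<open>c\<close> is chosen so that c r^n is \<open>K\<close> times the volume of a ball
      of radius r / 5.\<close>
    define K where "K = \<epsilon> / v"
    have K: "K > 0" using \<epsilon> v by (simp add: K_def)
    define c where "c = K * w / 5 ^ ?n"
    have c: "c > 0" using K w by (simp add: c_def)
    have "\<forall>x\<in>?S. \<exists>r. 0 < r \<and> r < 1 \<and> measure \<mu> (ball x r) < c * r ^ ?n"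
      using c by (auto simp: not_le)
    from bchoice[OF this] obtain r
      where "\<forall>x\<in>?S. 0 < r x \<and> r x < 1 \<and> measure \<mu> (ball x (r x)) < c * r x ^ ?n" ..
    then have r: "0 < r x \<and> r x < 1 \<and> measure \<mu> (ball x (r x)) < c * r x ^ ?n" if "x \<in> ?S" for x
      using that by (rule bspec)
    have "\<exists>T\<in>sets \<mu>. ?S \<subseteq> T \<and> emeasure \<mu> T \<le> ennreal K * emeasure lborel (ball (0::'a) (real m + 1))"
    proof (rule Vitali_measure_bound[where \<rho>="\<lambda>x. r x / 5"])
      fix x assume x: "x \<in> ?S"
      show "0 < r x / 5 \<and> r x / 5 \<le> 1" using r[OF x] by simp
      have "emeasure \<mu> (ball x (5 * (r x / 5))) = ennreal (measure \<mu> (ball x (r x)))"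
        by (simp add: emeasure_eq_measure)
      also have "\<dots> \<le> ennreal (K * (w * (r x / 5) ^ ?n))"
        using r[OF x] by (intro ennreal_leI) (simp add: c_def power_divide mult_ac)
      also have "\<dots> = ennreal K * emeasure lborel (ball x (r x / 5))"
        using r[OF x] K w by (subst emeasure_ball) (auto simp: w_def ennreal_mult'[symmetric])
      finally show "emeasure \<mu> (ball x (5 * (r x / 5))) \<le> ennreal K * emeasure lborel (ball x (r x / 5))" .
      show "ball x (r x / 5) \<subseteq> ball 0 (real m + 1)"
        using x r[OF x] by (simp add: ball_subset_ball_iff dist_commute)
    qed (auto simp: sets_eq)
    moreover have "ennreal K * emeasure lborel (ball (0::'a) (real m + 1)) = ennreal \<epsilon>"
      using K v by (subst emeasure_ball) (auto simp: K_def v_def w_def ennreal_mult'[symmetric])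
    ultimately show "\<exists>T\<in>sets \<mu>. ?S \<subseteq> T \<and> emeasure \<mu> T \<le> ennreal \<epsilon>" by simp
  qed
  then have "AE x in \<mu>. \<forall>m::nat. x \<in> ball 0 (real m) \<longrightarrow> ?P x"
    unfolding AE_all_countable ..
  then show ?thesis
  proof eventually_elim
    case (elim x)
    obtain m :: nat where "norm x < real m" using reals_Archimedean2 by blast
    then show ?case using elim by (metis dist_0_norm mem_ball)
  qed
qed

text \<open>At a bad point of \<open>E\<close>, doubling and the excess outside \<open>E\<close>
  combine to \<mu>(B(x, 5 R)) \<le> (L / \<theta>) \<mu>(B(x, R) - E). Inside an open V around E
  with \<mu>(V - E) small, the covering lemma then bounds the bad set by (L / \<theta>) \<mu>(V -
  E).\<close>

lemma AE_density_at_doubling_scales: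
  assumes E: "E \<in> sets borel" and "L > 0" "\<theta> > 0"
  shows "AE x in \<mu>. x \<in> E \<longrightarrow> (\<exists>\<delta>>0. \<forall>R. 0 < R \<and> R < \<delta> \<and>
     measure \<mu> (ball x (5 * R)) \<le> L * measure \<mu> (ball x R) \<longrightarrow>
     measure \<mu> (ball x R - E) \<le> \<theta> * measure \<mu> (ball x R))"
    (is "AE x in \<mu>. x \<in> E \<longrightarrow> (\<exists>\<delta>>0. ?P x \<delta>)")
proof (rule AE_I_small)
  fix \<epsilon> :: real assume \<epsilon>: "\<epsilon> > 0"
  let ?S = "{x \<in> space \<mu>. \<not> (x \<in> E \<longrightarrow> (\<exists>\<delta>>0. ?P x \<delta>))}"
  define K where "K = L / \<theta>"
  have K: "K > 0" using assms by (simp add: K_def)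
  have "emeasure \<mu> E = (INF U \<in> {U. E \<subseteq> U \<and> open U}. emeasure \<mu> U)"
    by (rule outer_regular) (auto simp: sets_eq E)
  moreover have "emeasure \<mu> E < emeasure \<mu> E + ennreal (\<epsilon> / K)"
    using \<epsilon> K by (simp add: emeasure_eq_measure ennreal_less_iff flip: ennreal_plus)
  ultimately obtain V where V: "E \<subseteq> V" "open V" "emeasure \<mu> V < emeasure \<mu> E + ennreal (\<epsilon> / K)"
    by (auto simp: INF_less_iff)
  have "emeasure \<mu> V = emeasure \<mu> E + emeasure \<mu> (V - E)"
    using V E by (subst plus_emeasure) (auto simp: sets_eq Un_absorb1)
  then have VE: "emeasure \<mu> (V - E) \<le> ennreal (\<epsilon> / K)"
    using V(3) \<epsilon> K
    by (simp add: emeasure_eq_measure ennreal_less_iff ennreal_le_iff flip: ennreal_plus)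
  define N where "N = density \<mu> (indicator (- E))"
  have N: "emeasure N A = emeasure \<mu> (A - E)" if "A \<in> sets borel" for A
    using that E unfolding N_def
    by (subst emeasure_density)
       (auto simp: sets_eq nn_integral_indicator[symmetric] indicator_def[abs_def] sets.Diff
             intro!: nn_integral_cong simp del: nn_integral_indicator)
  have "\<forall>x\<in>?S. \<exists>R. 0 < R \<and> R \<le> 1 \<and> ball x R \<subseteq> V \<and>
     measure \<mu> (ball x (5 * R)) \<le> L * measure \<mu> (ball x R) \<and>
     \<theta> * measure \<mu> (ball x R) < measure \<mu> (ball x R - E)"
  proof
    fix x assume x: "x \<in> ?S"
    have "x \<in> V" using x V by auto
    then obtain d where d: "d > 0" "ball x d \<subseteq> V" using V(2) open_contains_ball by blast
    have "min d 1 > 0" using d by simp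
    then have "\<not> ?P x (min d 1)" using x by blast
    then obtain R where "0 < R" "R < min d 1" "measure \<mu> (ball x (5 * R)) \<le> L * measure \<mu> (ball x R)"
      "\<theta> * measure \<mu> (ball x R) < measure \<mu> (ball x R - E)" by (auto simp: not_le)
    moreover have "ball x R \<subseteq> V" using d \<open>R < min d 1\<close> subset_ball[of R d x] by simp
    ultimately show "\<exists>R. 0 < R \<and> R \<le> 1 \<and> ball x R \<subseteq> V \<and>
     measure \<mu> (ball x (5 * R)) \<le> L * measure \<mu> (ball x R) \<and>
     \<theta> * measure \<mu> (ball x R) < measure \<mu> (ball x R - E)" by (intro exI[of _ R]) auto
  qed
  from bchoice[OF this] obtain \<rho> where "\<forall>x\<in>?S. 0 < \<rho> x \<and> \<rho> x \<le> 1 \<and> ball x (\<rho> x) \<subseteq> V \<and>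
      measure \<mu> (ball x (5 * \<rho> x)) \<le> L * measure \<mu> (ball x (\<rho> x)) \<and>
     \<theta> * measure \<mu> (ball x (\<rho> x)) < measure \<mu> (ball x (\<rho> x) - E)" ..
  note \<rho> = bspec[OF this]
  have "\<exists>T\<in>sets \<mu>. ?S \<subseteq> T \<and> emeasure \<mu> T \<le> ennreal K * emeasure N V"
  proof (rule Vitali_measure_bound[where \<rho>=\<rho>])
    fix x assume x: "x \<in> ?S"
    note \<rho>x = \<rho>[OF x]
    show "0 < \<rho> x \<and> \<rho> x \<le> 1" "ball x (\<rho> x) \<subseteq> V" using \<rho>x by auto
    have "measure \<mu> (ball x (5 * \<rho> x)) \<le> K * (\<theta> * measure \<mu> (ball x (\<rho> x)))"
      using \<rho>x assms by (simp add: K_def)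
    also have "\<dots> \<le> K * measure \<mu> (ball x (\<rho> x) - E)" using \<rho>x K by (intro mult_left_mono) auto
    finally show "emeasure \<mu> (ball x (5 * \<rho> x)) \<le> ennreal K * emeasure N (ball x (\<rho> x))"
      using K by (simp add: N emeasure_eq_measure ennreal_mult'[symmetric] ennreal_leI)
  qed (use V in \<open>auto simp: sets_eq N_def\<close>)
  moreover have "ennreal K * emeasure N V \<le> ennreal \<epsilon>"
  proof -
    have "ennreal K * emeasure N V \<le> ennreal K * ennreal (\<epsilon> / K)"
      using VE V(2) by (intro mult_left_mono) (auto simp: N)
    also have "\<dots> = ennreal \<epsilon>" using K \<epsilon> by (simp add: ennreal_mult'[symmetric])
    finally show ?thesis .
  qed
  ultimately show "\<exists>T\<in>sets \<mu>. ?S \<subseteq> T \<and> emeasure \<mu> T \<le> ennreal \<epsilon>" using order_trans by blast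
qed

text \<open>If every enlargement by 5 multiplied the mass by more than \<open>L\<close>, the mass
  would exceed the total mass. The least index at which the growth stops is taken, so that the
  factor \<open>L ^ k\<close> has been gained on the way.\<close>

lemma exists_doubling_scale:
  assumes pos: "measure \<mu> (ball x r) > 0" and r: "r > 0" and L: "L > 1"
  obtains k where "measure \<mu> (ball x (5 * (5 ^ k * r))) \<le> L * measure \<mu> (ball x (5 ^ k * r))"
    "L ^ k * measure \<mu> (ball x r) \<le> measure \<mu> (ball x (5 ^ k * r))"
proof -
  define h where "h k = measure \<mu> (ball x (5 ^ k * r))" for k
  have h_Suc: "h (Suc k) = measure \<mu> (ball x (5 * (5 ^ k * r)))" for k by (simp add: h_def mult.assoc)
  have climb: "L ^ k * h 0 \<le> h k" if "\<And>j. j < k \<Longrightarrow> L * h j < h (Suc j)" for k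
    using that
  proof (induction k)
    case (Suc k)
    have "L ^ Suc k * h 0 = L * (L ^ k * h 0)" by simp
    also have "\<dots> \<le> L * h k" using Suc L by (intro mult_left_mono) auto
    also have "\<dots> \<le> h (Suc k)" using Suc.prems[of k] by simp
    finally show ?case .
  qed simp
  have "\<exists>k. h (Suc k) \<le> L * h k"
  proof (rule ccontr)
    assume "\<not> ?thesis"
    then have "L ^ k * h 0 \<le> h k" for k by (intro climb) (auto simp: not_le)
    then have bd: "L ^ k * h 0 \<le> measure \<mu> (space \<mu>)" for k
      using bounded_measure order_trans unfolding h_def by blast
    obtain k where "measure \<mu> (space \<mu>) / h 0 < L ^ k" using real_arch_pow[OF L] by blast
    then have "measure \<mu> (space \<mu>) < L ^ k * h 0" using pos by (simp add: h_def divide_less_eq)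
    then show False using bd[of k] by simp
  qed
  then obtain k where k: "h (Suc k) \<le> L * h k" "\<And>j. j < k \<Longrightarrow> \<not> h (Suc j) \<le> L * h j"
    using exists_least_iff[of "\<lambda>k. h (Suc k) \<le> L * h k"] by blast
  have "L ^ k * h 0 \<le> h k" using k(2) by (intro climb) (auto simp: not_le)
  then show ?thesis using that[of k] k(1) unfolding h_Suc by (simp add: h_def)
qed

text \<open>If the ball of radius r is too heavy, climb through 5 r, 25 r, ... until the measure is
  doubling. By the lower density bound this happens at a radius of order sqrt r at most, and the
  ball found there is still too heavy. At doubling radii the elementary Vitali lemma yields density
  points, so that no Besicovitch covering is needed.\<close>
lemma AE_upper_growth:
  fixes \<nu> :: "'a \<Rightarrow> 'a"
  assumes \<nu> [measurable]: "\<nu> \<in> borel_measurable \<mu>" and \<nu>1: "AE x in \<mu>. norm (\<nu> x) = 1"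
    and K: "K \<ge> 0" and s: "s \<le> 2 * real DIM('a)"
    and bound: "\<And>x r e. r > 0 \<Longrightarrow> norm e \<le> 2 \<Longrightarrow> (\<integral>y. indicator (ball x r) y * (e \<bullet> \<nu> y) \<partial>\<mu>) \<le> K * r powr s"
  shows "AE x in \<mu>. \<exists>rx>0. \<forall>r. 0 < r \<and> r < rx \<longrightarrow> measure \<mu> (ball x r) \<le> 2 * K * r powr s"
proof -
  define n where "n = DIM('a)"
  have n: "n > 0" by (simp add: n_def)
  \<comment> \<open>The exponent 2 n gives L^k = (5^k)^(2 n), which dominates (5^k)^s by the
    assumption on \<open>s\<close> and makes R^(2 n) at most a constant times r^n.\<close>
  define L where "L = (5::real) ^ (2 * n)"
  have L: "L > 1" using n by (simp add: L_def)
  \<comment> \<open>For \<open>e\<close> in a countable dense set these sets cover the space. The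
    tolerance 1/4 only guarantees norm e \<le> 5/4 for the vectors that are used.\<close>
  define E where "E e = {y. norm (\<nu> y - e) < 1 / 4}" for e
  have E [measurable]: "E e \<in> sets borel" for e
  proof -
    have "E e = \<nu> -` ball e (1 / 4) \<inter> space \<mu>" by (auto simp: E_def dist_norm norm_minus_commute)
    then show ?thesis using measurable_sets[OF \<nu>, of "ball e (1/4)"] by (simp add: sets_eq)
  qed
  obtain Q :: "'a set" where Q: "countable Q" "\<And>X. open X \<Longrightarrow> X \<noteq> {} \<Longrightarrow> \<exists>d\<in>Q. d \<in> X"
    using countable_dense_setE by blast
  have dens: "AE x in \<mu>. \<forall>e\<in>Q. x \<in> E e \<longrightarrow> (\<exists>\<delta>>0. \<forall>R. 0 < R \<and> R < \<delta> \<and>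
     measure \<mu> (ball x (5 * R)) \<le> L * measure \<mu> (ball x R) \<longrightarrow>
     measure \<mu> (ball x R - E e) \<le> 1 / 8 * measure \<mu> (ball x R))"
    unfolding AE_ball_countable[OF Q(1)]
    by (intro ballI AE_density_at_doubling_scales) (use L in auto)
  have good: "measure \<mu> (ball x R) \<le> 2 * K * R powr s"
    if R: "R > 0" and small: "measure \<mu> (ball x R - E e) \<le> 1 / 8 * measure \<mu> (ball x R)"
    and e54: "norm e \<le> 5 / 4" for x R e
  proof -
    have e: "norm e \<le> 2" using e54 by simp
    let ?B = "ball x R"
    \<comment> \<open>On \<open>E e\<close> one has e . \<nu> \<ge> 3/4, elsewhere e . \<nu> \<ge>
      -5/4 = 3/4 - 2. With at most 1/8 of the mass outside \<open>E e\<close> the left side is at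
      least half of the mass of the ball, whence the factor 2 in the conclusion.\<close>
    have "3 / 4 * measure \<mu> ?B - 2 * measure \<mu> (?B - E e)
        = (\<integral>y. 3 / 4 * indicator ?B y - 2 * indicator (?B - E e) y \<partial>\<mu>)"
      by (subst Bochner_Integration.integral_diff) (auto simp: emeasure_eq_measure)
    also have "\<dots> \<le> (\<integral>y. indicator ?B y * (e \<bullet> \<nu> y) \<partial>\<mu>)"
    proof (rule integral_mono_AE)
      show "integrable \<mu> (\<lambda>y. 3 / 4 * indicator ?B y - 2 * indicator (?B - E e) y :: real)"
        by (intro Bochner_Integration.integrable_diff) (auto simp: emeasure_eq_measure)
      have "AE y in \<mu>. norm (indicator ?B y * (e \<bullet> \<nu> y)) \<le> 2"
        using \<nu>1
      proof eventually_elim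
        case (elim y)
        have "\<bar>e \<bullet> \<nu> y\<bar> \<le> norm e * norm (\<nu> y)" by (rule Cauchy_Schwarz_ineq2)
        then show ?case using elim e by (auto simp: indicator_def)
      qed
      then show "integrable \<mu> (\<lambda>y. indicator ?B y * (e \<bullet> \<nu> y))"
        by (intro integrable_const_bound[where B=2] borel_measurable_times borel_measurable_inner
            borel_measurable_indicator borel_measurable_const \<nu>) (auto simp: sets_eq)
      show "AE y in \<mu>. 3 / 4 * indicator ?B y - 2 * indicator (?B - E e) y \<le> indicator ?B y * (e \<bullet> \<nu> y)"
        using \<nu>1
      proof eventually_elim
        case (elim y)
        have 1: "\<bar>e \<bullet> \<nu> y\<bar> \<le> 5 / 4" using Cauchy_Schwarz_ineq2[of e "\<nu> y"] elim e54 by simp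
        have "e \<bullet> \<nu> y \<ge> 3 / 4" if "y \<in> E e"
        proof -
          have "e \<bullet> \<nu> y = \<nu> y \<bullet> \<nu> y - (\<nu> y - e) \<bullet> \<nu> y" by (simp add: inner_diff_left)
          moreover have "\<nu> y \<bullet> \<nu> y = 1" using elim by (simp add: dot_square_norm)
          moreover have "\<bar>(\<nu> y - e) \<bullet> \<nu> y\<bar> \<le> 1 / 4"
            using Cauchy_Schwarz_ineq2[of "\<nu> y - e" "\<nu> y"] elim that by (simp add: E_def)
          ultimately show ?thesis by linarith
        qed
        then show ?case using 1 by (auto simp: indicator_def)
      qed
    qed
    also have "\<dots> \<le> K * R powr s" by (rule bound[OF R e])
    finally show ?thesis using small by simp
  qed
  show ?thesis using \<nu>1 dens AE_lower_density
  proof eventually_elim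
    case (elim x)
    obtain e where e: "e \<in> Q" "norm (\<nu> x - e) < 1 / 4"
      using Q(2)[of "ball (\<nu> x) (1/4)"] by (auto simp: dist_norm)
    have ne: "norm e \<le> 5 / 4" using e(2) elim(1) norm_triangle_ineq2[of e "\<nu> x"]
      by (simp add: norm_minus_commute)
    obtain \<delta> where \<delta>: "\<delta> > 0" "\<And>R. 0 < R \<Longrightarrow> R < \<delta> \<Longrightarrow>
       measure \<mu> (ball x (5 * R)) \<le> L * measure \<mu> (ball x R) \<Longrightarrow>
       measure \<mu> (ball x R - E e) \<le> 1 / 8 * measure \<mu> (ball x R)"
      using elim(2) e by (auto simp: E_def)
    obtain c where c: "c > 0" "\<And>r. 0 < r \<Longrightarrow> r < 1 \<Longrightarrow> c * r ^ n \<le> measure \<mu> (ball x r)"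
      using elim(3) by (auto simp: n_def)
    define m where "m = measure \<mu> (space \<mu>)"
    \<comment> \<open>The 1 allows the lower density bound. The other term turns R^(2 n) \<le> (m /
      c) r^n into R < \<delta>: replacing m / c by (1 + m / c)^n avoids an n-th root.\<close>
    define rx where "rx = min 1 (\<delta>\<^sup>2 / (1 + m / c))"
    have m: "m \<ge> 0" by (simp add: m_def)
    have rx: "rx > 0" using \<delta> c m by (auto simp: rx_def add_pos_nonneg)
    have "measure \<mu> (ball x r) \<le> 2 * K * r powr s" if r: "0 < r" "r < rx" for r
    proof (rule ccontr)
      assume bad: "\<not> ?thesis"
      have K0: "2 * K * r powr s \<ge> 0" using K by simp
      then have pos: "measure \<mu> (ball x r) > 0" using bad by linarith
      obtain k where k: "measure \<mu> (ball x (5 * (5 ^ k * r))) \<le> L * measure \<mu> (ball x (5 ^ k * r))"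
        "L ^ k * measure \<mu> (ball x r) \<le> measure \<mu> (ball x (5 ^ k * r))"
        using exists_doubling_scale[OF pos r(1) L] .
      define R where "R = 5 ^ k * r"
      have R: "R > 0" using r by (simp add: R_def)
      have Lk: "L ^ k = (5 ^ k) ^ (2 * n)" by (simp add: L_def mult.commute flip: power_mult)
      have "(R\<^sup>2) ^ n < (\<delta>\<^sup>2) ^ n"
      proof -
        have "c * r ^ n * L ^ k \<le> measure \<mu> (ball x r) * L ^ k"
          using c(2)[of r] r L by (intro mult_right_mono) (auto simp: rx_def)
        also have "\<dots> \<le> m" using k(2) bounded_measure[of "ball x (5 ^ k * r)"] by (simp add: m_def mult.commute)
        finally have 1: "L ^ k * r ^ n \<le> m / c" using c by (simp add: field_simps)
        have "(R\<^sup>2) ^ n = L ^ k * r ^ n * r ^ n"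
          by (simp add: R_def Lk power_mult_distrib power_mult power2_eq_square)
        also have "\<dots> \<le> (m / c) * r ^ n" using 1 r by (intro mult_right_mono) auto
        also have "\<dots> \<le> (1 + m / c) ^ n * r ^ n"
        proof (intro mult_right_mono)
          have "m / c \<le> 1 + m / c" by simp
          also have "\<dots> \<le> (1 + m / c) ^ n" using m c n by (intro self_le_power) auto
          finally show "m / c \<le> (1 + m / c) ^ n" .
        qed (use r in auto)
        also have "\<dots> = ((1 + m / c) * r) ^ n" by (simp add: power_mult_distrib)
        also have "\<dots> < (\<delta>\<^sup>2) ^ n"
        proof (rule power_strict_mono)
          have "1 + m / c > 0" using m c by (simp add: add_pos_nonneg)
          moreover have "r < \<delta>\<^sup>2 / (1 + m / c)" using r by (simp add: rx_def)
          ultimately show "(1 + m / c) * r < \<delta>\<^sup>2" by (simp add: less_divide_eq mult.commute)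
        qed (use m c r n in auto)
        finally show ?thesis .
      qed
      then have "R < \<delta>" using R \<delta>(1) by (meson less_imp_le not_le power_mono zero_le_power)
      then have small: "measure \<mu> (ball x R - E e) \<le> 1 / 8 * measure \<mu> (ball x R)"
        using \<delta>(2)[OF R] k(1) by (simp add: R_def)
      \<comment> \<open>Passing from \<open>r\<close> to \<open>R\<close> multiplies the bound by at
        most \<open>L ^ k\<close> and the mass by at least \<open>L ^ k\<close>; the violation at
        \<open>r\<close> would therefore persist at \<open>R\<close>.\<close>
      have "measure \<mu> (ball x R) \<le> 2 * K * R powr s"
        using good[OF R small ne] by simp
      also have "\<dots> = (5 ^ k) powr s * (2 * K * r powr s)"
        using r by (simp add: R_def powr_mult)
      also have "\<dots> \<le> L ^ k * (2 * K * r powr s)"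
      proof (intro mult_right_mono K0)
        have "(5 ^ k) powr s \<le> (5 ^ k :: real) powr real (2 * n)"
          using s by (intro powr_mono) (auto simp: n_def)
        also have "\<dots> = L ^ k" unfolding Lk by (rule powr_realpow) simp
        finally show "(5 ^ k) powr s \<le> L ^ k" .
      qed
      also have "\<dots> < L ^ k * measure \<mu> (ball x r)" using bad L by (intro mult_strict_left_mono) auto
      also have "\<dots> \<le> measure \<mu> (ball x R)" using k(2) by (simp add: R_def)
      finally show False by simp
    qed
    then show ?case using rx by blast
  qed
qed

end

section \<open>Fractional potentials of balls\<close>

text \<open>Polar coordinates for radial functions. It suffices to compare half-lines: there the
  left side is the volume w a^n of a ball, and the density on the right is its derivative in
  a.\<close>

lemma distr_norm_lborel:
  "distr lborel borel (norm :: 'a::euclidean_space \<Rightarrow> real) =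
   density lborel (\<lambda>t. ennreal (real DIM('a) * unit_ball_vol (real DIM('a)) * t ^ (DIM('a) - 1)) * indicator {0..} t)"
  (is "?M = ?N")
proof (rule measure_eqI_generator_eq[where E="range atMost" and \<Omega>=UNIV and A="\<lambda>i. {.. real i}"])
  let ?n = "DIM('a)" and ?w = "unit_ball_vol (real DIM('a))"
  show "Int_stable (range (atMost :: real \<Rightarrow> _))"
    by (auto simp: Int_stable_def min_def)
  have borel: "sets (borel :: real measure) = sigma_sets UNIV (range atMost)"
    using arg_cong[OF borel_eq_atMost[where 'a=real], of sets] by simp
  then show "sets ?M = sigma_sets UNIV (range atMost)" "sets ?N = sigma_sets UNIV (range atMost)"
    by simp_all
  have M: "emeasure ?M {..a} = ennreal (if a < 0 then 0 else ?w * a ^ ?n)" for a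
  proof -
    have "emeasure ?M {..a} = emeasure lborel (cball (0::'a) a)"
      by (subst emeasure_distr) (auto simp: cball_def intro!: arg_cong[of _ _ "emeasure lborel"])
    then show ?thesis by (cases "a < 0") (auto simp: emeasure_cball)
  qed
  have N: "emeasure ?N {..a} = ennreal (if a < 0 then 0 else ?w * a ^ ?n)" for a
  proof -
    have "emeasure ?N {..a} = (\<integral>\<^sup>+t. ennreal (real ?n * ?w * t ^ (?n - 1)) * indicator {0..a} t \<partial>lborel)"
      by (subst emeasure_density) (auto simp: indicator_def intro!: nn_integral_cong)
    also have "\<dots> = ennreal (if a < 0 then 0 else ?w * a ^ ?n)"
    proof (cases "a < 0")
      case False
      have "(\<integral>\<^sup>+t. ennreal (real ?n * ?w * t ^ (?n - 1)) * indicator {0..a} t \<partial>lborel)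
          = ennreal (?w * a ^ ?n - ?w * 0 ^ ?n)"
        by (rule nn_integral_FTC_Icc) (use False in \<open>auto intro!: derivative_eq_intros\<close>)
      then show ?thesis using False by simp
    qed auto
    finally show ?thesis .
  qed
  show "emeasure ?M X = emeasure ?N X" if "X \<in> range atMost" for X
    using that M N by auto
  show "emeasure ?M {..real i} \<noteq> \<infinity>" for i by (simp add: M)
  show "(\<Union>i. {..real i}) = UNIV" using real_arch_simple by auto
qed auto

lemma nn_integral_lborel_translate:
  fixes c :: "'a::euclidean_space"
  assumes [measurable]: "h \<in> borel_measurable borel"
  shows "(\<integral>\<^sup>+y. h (y - c) \<partial>lborel) = (\<integral>\<^sup>+y. h y \<partial>lborel)"
proof -
  have "(\<integral>\<^sup>+y. h y \<partial>lborel) = (\<integral>\<^sup>+y. h y \<partial>distr lborel borel ((+) (- c)))"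
    by (simp add: lborel_distr_plus)
  also have "\<dots> = (\<integral>\<^sup>+y. h (y - c) \<partial>lborel)" by (subst nn_integral_distr) auto
  finally show ?thesis ..
qed

lemma nn_integral_radial:
  fixes c :: "'a::euclidean_space"
  assumes g [measurable]: "g \<in> borel_measurable borel"
  shows "(\<integral>\<^sup>+y. g (norm (y - c)) \<partial>lborel) =
    (\<integral>\<^sup>+t. ennreal (real DIM('a) * unit_ball_vol (real DIM('a)) * t ^ (DIM('a) - 1)) * indicator {0..} t * g t \<partial>lborel)"
proof -
  have "(\<integral>\<^sup>+y. g (norm (y - c)) \<partial>lborel) = (\<integral>\<^sup>+y. g (norm (y::'a)) \<partial>lborel)"
    by (rule nn_integral_lborel_translate) measurable
  also have "\<dots> = (\<integral>\<^sup>+t. g t \<partial>distr lborel borel (norm :: 'a \<Rightarrow> real))"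
    by (subst nn_integral_distr) auto
  finally show ?thesis unfolding distr_norm_lborel
    by (subst (asm) nn_integral_density) auto
qed

text \<open>Serves both the fractional potential near a sphere, with d the distance to it, and the
  tails at infinity.\<close>

lemma nn_integral_norm_powr_outside:
  fixes c :: "'a::euclidean_space"
  assumes d: "d > 0" and \<gamma>: "\<gamma> > real DIM('a)"
  shows "(\<integral>\<^sup>+y. ennreal (norm (y - c) powr - \<gamma>) * indicator {d..} (norm (y - c)) \<partial>lborel) =
    ennreal (real DIM('a) * unit_ball_vol (real DIM('a)) / (\<gamma> - real DIM('a)) * d powr (real DIM('a) - \<gamma>))"
proof -
  let ?n = "DIM('a)" and ?w = "unit_ball_vol (real DIM('a))"
  have "(\<integral>\<^sup>+y. ennreal (norm (y - c) powr - \<gamma>) * indicator {d..} (norm (y - c)) \<partial>lborel) =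
     (\<integral>\<^sup>+t. ennreal (real ?n * ?w * t ^ (?n - 1)) * indicator {0..} t * (ennreal (t powr - \<gamma>) * indicator {d..} t) \<partial>lborel)"
    by (rule nn_integral_radial) measurable
  also have "\<dots> = (\<integral>\<^sup>+t. ennreal (real ?n * ?w) * (ennreal (t powr (real ?n - 1 - \<gamma>)) * indicator {d..} t) \<partial>lborel)"
  proof (rule nn_integral_cong)
    fix t :: real
    show "ennreal (real ?n * ?w * t ^ (?n - 1)) * indicator {0..} t * (ennreal (t powr - \<gamma>) * indicator {d..} t)
      = ennreal (real ?n * ?w) * (ennreal (t powr (real ?n - 1 - \<gamma>)) * indicator {d..} t)"
    proof (cases "d \<le> t")
      case True
      then have t: "t > 0" using d by simp
      have "t ^ (?n - 1) * t powr - \<gamma> = t powr (real ?n - 1 - \<gamma>)"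
        using t by (simp add: powr_realpow[symmetric] powr_add[symmetric] of_nat_diff)
      then show ?thesis using True t
        by (simp add: ennreal_mult'[symmetric] mult.assoc)
    qed auto
  qed
  also have "\<dots> = ennreal (real ?n * ?w) * (\<integral>\<^sup>+t. ennreal (t powr (real ?n - 1 - \<gamma>)) * indicator {d..} t \<partial>lborel)"
    by (rule nn_integral_cmult) measurable
  also have "(\<integral>\<^sup>+t. ennreal (t powr (real ?n - 1 - \<gamma>)) * indicator {d..} t \<partial>lborel)
     = ennreal (- (d powr (real ?n - 1 - \<gamma> + 1)) / (real ?n - 1 - \<gamma> + 1))"
    by (rule nn_integral_has_integral_lebesgue'[OF _ has_integral_powr_to_inf]) (use d \<gamma> in auto)
  also have "- (d powr (real ?n - 1 - \<gamma> + 1)) / (real ?n - 1 - \<gamma> + 1) = d powr (real ?n - \<gamma>) / (\<gamma> - real ?n)"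
    using \<gamma> by (simp add: field_simps)
  finally show ?thesis using \<gamma> by (simp add: ennreal_mult'[symmetric])
qed

lemma nn_integral_norm_powr_inside:
  fixes c :: "'a::euclidean_space"
  assumes \<gamma>: "\<gamma> < real DIM('a)"
  shows "(\<integral>\<^sup>+y. ennreal (norm (y - c) powr - \<gamma>) * indicator {0..1} (norm (y - c)) \<partial>lborel) < \<infinity>"
proof -
  let ?n = "DIM('a)" and ?w = "unit_ball_vol (real DIM('a))"
  have "(\<integral>\<^sup>+y. ennreal (norm (y - c) powr - \<gamma>) * indicator {0..1} (norm (y - c)) \<partial>lborel) =
     (\<integral>\<^sup>+t. ennreal (real ?n * ?w * t ^ (?n - 1)) * indicator {0..} t * (ennreal (t powr - \<gamma>) * indicator {0..1} t) \<partial>lborel)"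
    by (rule nn_integral_radial) measurable
  also have "\<dots> = (\<integral>\<^sup>+t. ennreal (real ?n * ?w) * (ennreal (t powr (real ?n - 1 - \<gamma>)) * indicator {0..1} t) \<partial>lborel)"
  proof (rule nn_integral_cong)
    fix t :: real
    show "ennreal (real ?n * ?w * t ^ (?n - 1)) * indicator {0..} t * (ennreal (t powr - \<gamma>) * indicator {0..1} t)
      = ennreal (real ?n * ?w) * (ennreal (t powr (real ?n - 1 - \<gamma>)) * indicator {0..1} t)"
    proof (cases "0 < t \<and> t \<le> 1")
      case True
      then have t: "t > 0" by simp
      have "t ^ (?n - 1) * t powr - \<gamma> = t powr (real ?n - 1 - \<gamma>)"
        using t by (simp add: powr_realpow[symmetric] powr_add[symmetric] of_nat_diff)
      then show ?thesis using True t
        by (simp add: ennreal_mult'[symmetric] mult.assoc)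
    qed (auto simp: indicator_def)
  qed
  also have "\<dots> = ennreal (real ?n * ?w) * (\<integral>\<^sup>+t. ennreal (t powr (real ?n - 1 - \<gamma>)) * indicator {0..1} t \<partial>lborel)"
    by (rule nn_integral_cmult) measurable
  also have "(\<integral>\<^sup>+t. ennreal (t powr (real ?n - 1 - \<gamma>)) * indicator {0..1} t \<partial>lborel)
     = ennreal (1 powr (real ?n - 1 - \<gamma> + 1) / (real ?n - 1 - \<gamma> + 1))"
    by (rule nn_integral_has_integral_lebesgue'[OF _ has_integral_powr_from_0]) (use \<gamma> in auto)
  finally show ?thesis by (simp add: ennreal_mult_less_top)
qed

text \<open>Each side of the singularity is an affine image of u^(-\<beta>) on (0, s), integrable
  because \<beta> < 1.\<close>

lemma nn_integral_abs_powr_around: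
  fixes s \<beta> :: real
  assumes "\<beta> < 1" "s > 0"
  shows "(\<integral>\<^sup>+t. ennreal (\<bar>t - s\<bar> powr - \<beta>) * indicator {0..2 * s} t \<partial>lborel)
    \<le> ennreal (2 * s powr (1 - \<beta>) / (1 - \<beta>))"
proof -
  let ?f = "\<lambda>u. ennreal (u powr - \<beta>) * indicator {0..s} u"
  have f: "(\<integral>\<^sup>+u. ?f u \<partial>lborel) = ennreal (s powr (1 - \<beta>) / (1 - \<beta>))"
    using nn_integral_has_integral_lebesgue'[OF _ has_integral_powr_from_0[of "- \<beta>" s]] assms by simp
  have "(\<integral>\<^sup>+t. ennreal (\<bar>t - s\<bar> powr - \<beta>) * indicator {0..2 * s} t \<partial>lborel)
     \<le> (\<integral>\<^sup>+t. ?f (- s + 1 * t) + ?f (s + (-1) * t) \<partial>lborel)"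
    by (rule nn_integral_mono) (auto simp: indicator_def)
  also have "\<dots> = (\<integral>\<^sup>+t. ?f (- s + 1 * t) \<partial>lborel) + (\<integral>\<^sup>+t. ?f (s + (-1) * t) \<partial>lborel)"
    by (rule nn_integral_add) measurable
  also have "\<dots> = (\<integral>\<^sup>+u. ?f u \<partial>lborel) + (\<integral>\<^sup>+u. ?f u \<partial>lborel)"
    using nn_integral_real_affine[of ?f 1 "-s"] nn_integral_real_affine[of ?f "-1" s] by simp
  also have "\<dots> = ennreal (2 * s powr (1 - \<beta>) / (1 - \<beta>))"
    unfolding f using assms by (simp flip: ennreal_plus)
  finally show ?thesis .
qed

text \<open>For radii up to 2 s the Jacobian t^(n-1) is at most (2 s)^(n-1), which reduces the
  estimate to the one-dimensional singularity across the sphere.\<close>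

lemma nn_integral_powr_dist_sphere:
  fixes c :: "'a::euclidean_space"
  assumes "\<beta> < 1" "s > 0"
  shows "(\<integral>\<^sup>+y. ennreal (\<bar>norm (y - c) - s\<bar> powr - \<beta>) * indicator {0..2 * s} (norm (y - c)) \<partial>lborel) \<le>
    ennreal (real DIM('a) * unit_ball_vol (real DIM('a)) * 2 ^ DIM('a) / (1 - \<beta>) * s powr (real DIM('a) - \<beta>))"
proof -
  let ?n = "DIM('a)" and ?w = "unit_ball_vol (real DIM('a))"
  let ?C = "real ?n * ?w * (2 * s) ^ (?n - 1)"
  have "(\<integral>\<^sup>+y. ennreal (\<bar>norm (y - c) - s\<bar> powr - \<beta>) * indicator {0..2 * s} (norm (y - c)) \<partial>lborel) =
     (\<integral>\<^sup>+t. ennreal (real ?n * ?w * t ^ (?n - 1)) * indicator {0..} t * (ennreal (\<bar>t - s\<bar> powr - \<beta>) * indicator {0..2 * s} t) \<partial>lborel)"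
    by (rule nn_integral_radial) measurable
  also have "\<dots> \<le> (\<integral>\<^sup>+t. ennreal ?C * (ennreal (\<bar>t - s\<bar> powr - \<beta>) * indicator {0..2 * s} t) \<partial>lborel)"
  proof (rule nn_integral_mono)
    fix t :: real
    show "ennreal (real ?n * ?w * t ^ (?n - 1)) * indicator {0..} t * (ennreal (\<bar>t - s\<bar> powr - \<beta>) * indicator {0..2 * s} t)
      \<le> ennreal ?C * (ennreal (\<bar>t - s\<bar> powr - \<beta>) * indicator {0..2 * s} t)"
    proof (cases "t \<in> {0..2 * s}")
      case True
      then have "real ?n * ?w * t ^ (?n - 1) \<le> ?C" by (intro mult_left_mono power_mono) auto
      then show ?thesis using True by (auto intro!: mult_right_mono ennreal_leI)
    qed auto
  qed
  also have "\<dots> = ennreal ?C * (\<integral>\<^sup>+t. ennreal (\<bar>t - s\<bar> powr - \<beta>) * indicator {0..2 * s} t \<partial>lborel)"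
    by (rule nn_integral_cmult) measurable
  also have "\<dots> \<le> ennreal ?C * ennreal (2 * s powr (1 - \<beta>) / (1 - \<beta>))"
    by (intro mult_left_mono nn_integral_abs_powr_around assms) auto
  also have "\<dots> = ennreal (?C * (2 * s powr (1 - \<beta>) / (1 - \<beta>)))"
    using assms by (subst ennreal_mult) auto
  also have "?C * (2 * s powr (1 - \<beta>) / (1 - \<beta>)) = real ?n * ?w * 2 ^ ?n / (1 - \<beta>) * s powr (real ?n - \<beta>)"
  proof -
    have "2 ^ ?n = (2::real) * 2 ^ (?n - 1)" by (simp flip: power_Suc)
    moreover have "s powr (real ?n - \<beta>) = s ^ (?n - 1) * s powr (1 - \<beta>)"
      using assms by (simp add: powr_realpow[symmetric] powr_add[symmetric] of_nat_diff)
    ultimately show ?thesis by (simp add: power_mult_distrib)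
  qed
  finally show ?thesis .
qed

text \<open>The inner integral of the Gagliardo seminorm of W^(\<alpha>,1). It is extended-valued so
  that Tonelli applies without integrability conditions.\<close>

definition gagliardo :: "real \<Rightarrow> ('a::euclidean_space \<Rightarrow> real) \<Rightarrow> 'a \<Rightarrow> ennreal" where
  "gagliardo \<alpha> \<eta> x = (\<integral>\<^sup>+y. ennreal (\<bar>\<eta> y - \<eta> x\<bar> * norm (y - x) powr - (real DIM('a) + \<alpha>)) \<partial>lborel)"

text \<open>The first branch comes from the distance of x to the sphere, the second from the decay at
  infinity. On the sphere itself the bound has the junk value 0.\<close>
definition ball_potential :: "real \<Rightarrow> real \<Rightarrow> 'a::euclidean_space \<Rightarrow> 'a \<Rightarrow> real" where
  "ball_potential \<alpha> s c x =
    (if norm (x - c) < 2 * s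
     then real DIM('a) * unit_ball_vol (real DIM('a)) / \<alpha> * \<bar>norm (x - c) - s\<bar> powr - \<alpha>
     else unit_ball_vol (real DIM('a)) * s ^ DIM('a) * (norm (x - c) / 2) powr - (real DIM('a) + \<alpha>))"

lemma borel_measurable_ball_potential [measurable]: "ball_potential \<alpha> s c \<in> borel_measurable borel"
  unfolding ball_potential_def[abs_def] by measurable

lemma ball_potential_nonneg: "\<alpha> > 0 \<Longrightarrow> s > 0 \<Longrightarrow> ball_potential \<alpha> s c x \<ge> 0"
  by (auto simp: ball_potential_def)

text \<open>For x near the ball, the integrand vanishes unless y lies on the other side of the
  sphere, hence at distance at least | |x - c| - s |. For x far away only y in the ball contribute,
  and these satisfy |y - x| \<ge> |x - c| / 2.\<close>

lemma gagliardo_ball_le: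
  fixes c x :: "'a::euclidean_space"
  assumes \<alpha>: "\<alpha> > 0" and s: "s > 0" and x: "norm (x - c) \<noteq> s"
  shows "gagliardo \<alpha> (indicator (ball c s)) x \<le> ennreal (ball_potential \<alpha> s c x)"
proof (cases "norm (x - c) < 2 * s")
  case True
  define d where "d = \<bar>norm (x - c) - s\<bar>"
  have d: "d > 0" using x by (simp add: d_def)
  have far: "d \<le> norm (y - x)" if "indicator (ball c s) y \<noteq> (indicator (ball c s) x :: real)" for y
  proof -
    have "norm (y - c) \<le> norm (y - x) + norm (x - c)" "norm (x - c) \<le> norm (y - x) + norm (y - c)"
      using norm_triangle_ineq[of "y - x" "x - c"] norm_triangle_ineq[of "x - y" "y - c"]
      by (auto simp: norm_minus_commute)
    moreover have "norm (y - c) < s \<longleftrightarrow> \<not> norm (x - c) < s"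
      using that by (auto simp: indicator_def dist_norm norm_minus_commute split: if_splits)
    ultimately show ?thesis unfolding d_def by linarith
  qed
  have "gagliardo \<alpha> (indicator (ball c s)) x \<le>
     (\<integral>\<^sup>+y. ennreal (norm (y - x) powr - (real DIM('a) + \<alpha>)) * indicator {d..} (norm (y - x)) \<partial>lborel)"
    unfolding gagliardo_def
  proof (rule nn_integral_mono)
    fix y
    show "ennreal (\<bar>indicator (ball c s) y - indicator (ball c s) x\<bar> * norm (y - x) powr - (real DIM('a) + \<alpha>))
      \<le> ennreal (norm (y - x) powr - (real DIM('a) + \<alpha>)) * indicator {d..} (norm (y - x))"
    proof (cases "indicator (ball c s) y = (indicator (ball c s) x :: real)")
      case False
      then have "\<bar>indicator (ball c s) y - indicator (ball c s) x\<bar> = (1::real)"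
        by (auto simp: indicator_def split: if_splits)
      then show ?thesis using far[OF False] by simp
    qed simp
  qed
  also have "\<dots> = ennreal (ball_potential \<alpha> s c x)"
    using d \<alpha> True by (subst nn_integral_norm_powr_outside) (auto simp: ball_potential_def d_def)
  finally show ?thesis .
next
  case False
  let ?N = "(norm (x - c) / 2) powr - (real DIM('a) + \<alpha>)"
  have "gagliardo \<alpha> (indicator (ball c s)) x \<le> (\<integral>\<^sup>+y. ennreal ?N * indicator (ball c s) y \<partial>lborel)"
    unfolding gagliardo_def
  proof (rule nn_integral_mono)
    fix y
    show "ennreal (\<bar>indicator (ball c s) y - indicator (ball c s) x\<bar> * norm (y - x) powr - (real DIM('a) + \<alpha>))
      \<le> ennreal ?N * indicator (ball c s) y"
    proof (cases "y \<in> ball c s")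
      case True
      have "norm (x - c) \<le> norm (y - x) + norm (y - c)"
        using norm_triangle_ineq[of "x - y" "y - c"] by (auto simp: norm_minus_commute)
      moreover have "norm (y - c) < s" using True by (simp add: dist_norm norm_minus_commute)
      ultimately have "norm (x - c) / 2 \<le> norm (y - x)" using False by linarith
      then have "norm (y - x) powr - (real DIM('a) + \<alpha>) \<le> ?N"
        using \<alpha> s False by (intro powr_mono2') auto
      then show ?thesis using True False s
        by (auto simp: indicator_def dist_norm norm_minus_commute intro!: ennreal_leI)
    next
      case y: False
      then show ?thesis using False s by (simp add: indicator_def dist_norm norm_minus_commute)
    qed
  qed
  also have "\<dots> = ennreal (ball_potential \<alpha> s c x)"
    using False s by (subst nn_integral_cmult_indicator)
      (auto simp: emeasure_ball ball_potential_def ennreal_mult'[symmetric] mult_ac)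
  finally show ?thesis .
qed

text \<open>Integrability across the sphere requires \<alpha> q < 1, which is the hypothesis p > 1 / (1 - \<alpha>).\<close>
lemma ball_potential_power_integral:
  fixes \<alpha> q :: real
  assumes \<alpha>: "\<alpha> > 0" and q: "q \<ge> 1" and \<alpha>q: "\<alpha> * q < 1"
  obtains C where "C > 0" "\<And>s (c::'a::euclidean_space). s > 0 \<Longrightarrow>
    (\<integral>\<^sup>+x. ennreal (ball_potential \<alpha> s c x powr q) \<partial>lborel) \<le> ennreal (C * s powr (real DIM('a) - \<alpha> * q))"
proof -
  define n where "n = real DIM('a)"
  define w where "w = unit_ball_vol n"
  define \<gamma> where "\<gamma> = (n + \<alpha>) * q"
  have n: "n \<ge> 1" using DIM_positive[where 'a='a] by (simp add: n_def Suc_leI)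
  have w: "w > 0" using n by (simp add: w_def)
  have "n + \<alpha> \<le> \<gamma>" using q n \<alpha> by (simp add: \<gamma>_def)
  then have \<gamma>: "\<gamma> > n" using \<alpha> by simp
  \<comment> \<open>\<open>C1\<close> and \<open>C2\<close> are the coefficients of the two branches
    raised to the power q, \<open>D1\<close> and \<open>D2\<close> the constants of the radial
    integrals near the sphere and at infinity. The tail converges because \<gamma> > n.\<close>
  define C1 where "C1 = (n * w / \<alpha>) powr q"
  define C2 where "C2 = (w * 2 powr (n + \<alpha>)) powr q"
  define D1 where "D1 = n * w * 2 ^ DIM('a) / (1 - \<alpha> * q)"
  define D2 where "D2 = n * w / (\<gamma> - n) * 2 powr (n - \<gamma>)"
  define C where "C = C1 * D1 + C2 * D2"
  have pos: "C1 > 0" "C2 > 0" "D1 > 0" "D2 > 0"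
    using n w \<alpha> \<alpha>q \<gamma> by (auto simp: C1_def C2_def D1_def D2_def)
  have "(\<integral>\<^sup>+x. ennreal (ball_potential \<alpha> s c x powr q) \<partial>lborel) \<le> ennreal (C * s powr (n - \<alpha> * q))"
    if s: "s > 0" for s and c :: 'a
  proof -
    let ?A = "\<lambda>x. ennreal (\<bar>norm (x - c) - s\<bar> powr - (\<alpha> * q)) * indicator {0..2 * s} (norm (x - c))"
    let ?B = "\<lambda>x. ennreal (norm (x - c) powr - \<gamma>) * indicator {2 * s..} (norm (x - c))"
    have "(\<integral>\<^sup>+x. ennreal (ball_potential \<alpha> s c x powr q) \<partial>lborel)
       \<le> (\<integral>\<^sup>+x. ennreal C1 * ?A x + ennreal (C2 * s powr (n * q)) * ?B x \<partial>lborel)"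
    proof (rule nn_integral_mono)
      fix x
      show "ennreal (ball_potential \<alpha> s c x powr q)
         \<le> ennreal C1 * ?A x + ennreal (C2 * s powr (n * q)) * ?B x"
      proof (cases "norm (x - c) < 2 * s")
        case True
        have "ball_potential \<alpha> s c x powr q = (n * w / \<alpha> * \<bar>norm (x - c) - s\<bar> powr - \<alpha>) powr q"
          using True by (simp add: ball_potential_def n_def w_def)
        also have "\<dots> = C1 * \<bar>norm (x - c) - s\<bar> powr - (\<alpha> * q)"
          unfolding C1_def using n w \<alpha> by (subst powr_mult) (auto simp: powr_powr)
        finally have "ball_potential \<alpha> s c x powr q = C1 * \<bar>norm (x - c) - s\<bar> powr - (\<alpha> * q)" .
        then show ?thesis using True pos by (simp add: ennreal_mult'[symmetric])
      next
        case False
        define t where "t = norm (x - c)"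
        have t: "t \<ge> 2 * s" "t > 0" using False s by (auto simp: t_def)
        have "ball_potential \<alpha> s c x powr q = (w * s powr n * (t / 2) powr - (n + \<alpha>)) powr q"
          using False s by (simp add: ball_potential_def n_def w_def t_def powr_realpow)
        also have "(t / 2) powr - (n + \<alpha>) = 2 powr (n + \<alpha>) * t powr - (n + \<alpha>)"
        proof -
          have "(t / 2) powr - g = 2 powr g * t powr - g" for g
            using t by (simp add: powr_divide powr_minus field_simps)
          then show ?thesis .
        qed
        also have "(w * s powr n * (2 powr (n + \<alpha>) * t powr - (n + \<alpha>))) powr q
           = C2 * s powr (n * q) * t powr - \<gamma>"
        proof -
          have "(w * s powr n * (2 powr (n + \<alpha>) * t powr - (n + \<alpha>))) powr q
             = C2 * (s powr n) powr q * (t powr - (n + \<alpha>)) powr q"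
            unfolding C2_def using w by (simp add: powr_mult mult_ac)
          also have "(t powr - (n + \<alpha>)) powr q = t powr - \<gamma>"
            unfolding powr_powr \<gamma>_def by (simp only: minus_mult_left)
          finally show ?thesis by (simp add: powr_powr)
        qed
        finally have "ball_potential \<alpha> s c x powr q = C2 * s powr (n * q) * t powr - \<gamma>" .
        then show ?thesis using t pos by (simp add: ennreal_mult'[symmetric] t_def)
      qed
    qed
    also have "\<dots> = ennreal C1 * (\<integral>\<^sup>+x. ?A x \<partial>lborel) + ennreal (C2 * s powr (n * q)) * (\<integral>\<^sup>+x. ?B x \<partial>lborel)"
      by (subst nn_integral_add) (auto simp: nn_integral_cmult)
    also have "\<dots> \<le> ennreal C1 * ennreal (D1 * s powr (n - \<alpha> * q)) +
        ennreal (C2 * s powr (n * q)) * ennreal (D2 * s powr (n - \<gamma>))"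
    proof (intro add_mono mult_left_mono)
      show "(\<integral>\<^sup>+x. ?A x \<partial>lborel) \<le> ennreal (D1 * s powr (n - \<alpha> * q))"
        using nn_integral_powr_dist_sphere[OF \<alpha>q s, of c] by (simp add: D1_def n_def w_def)
      have "(\<integral>\<^sup>+x. ?B x \<partial>lborel) = ennreal (n * w / (\<gamma> - n) * (2 * s) powr (n - \<gamma>))"
        using nn_integral_norm_powr_outside[of "2 * s" \<gamma> c] s \<gamma> by (simp add: n_def w_def)
      then show "(\<integral>\<^sup>+x. ?B x \<partial>lborel) \<le> ennreal (D2 * s powr (n - \<gamma>))"
        using s by (simp add: D2_def powr_mult mult.assoc)
    qed auto
    also have "\<dots> = ennreal (C1 * (D1 * s powr (n - \<alpha> * q)) + C2 * s powr (n * q) * (D2 * s powr (n - \<gamma>)))"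
      using pos by (simp add: ennreal_mult'[symmetric] ennreal_plus[symmetric] del: ennreal_plus)
    \<comment> \<open>Scaling makes both contributions of the same order: n q + n - (n + \<alpha>) q
      = n - \<alpha> q.\<close>
    also have "s powr (n * q) * (D2 * s powr (n - \<gamma>)) = D2 * s powr (n - \<alpha> * q)"
    proof -
      have "s powr (n * q) * s powr (n - \<gamma>) = s powr (n - \<alpha> * q)"
        by (simp add: powr_add[symmetric] \<gamma>_def algebra_simps)
      then show ?thesis by simp
    qed
    then have "C1 * (D1 * s powr (n - \<alpha> * q)) + C2 * s powr (n * q) * (D2 * s powr (n - \<gamma>)) = C * s powr (n - \<alpha> * q)"
      by (simp add: C_def algebra_simps)
    finally show ?thesis .
  qed
  then show ?thesis using that[of C] pos by (auto simp: C_def n_def add_pos_pos)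
qed

section \<open>Lebesgue norms and the pairing of f with the potential\<close>

lemma nn_integral_Holder:
  fixes f g :: "'a \<Rightarrow> real"
  assumes [measurable]: "f \<in> borel_measurable M" "g \<in> borel_measurable M"
    and nn: "\<And>x. f x \<ge> 0" "\<And>x. g x \<ge> 0"
    and pq: "p > 1" "q > 1" "1 / p + 1 / q = 1"
    and a: "a \<ge> 0" "(\<integral>\<^sup>+x. ennreal (f x powr p) \<partial>M) \<le> ennreal (a powr p)"
    and b: "b \<ge> 0" "(\<integral>\<^sup>+x. ennreal (g x powr q) \<partial>M) \<le> ennreal (b powr q)"
  shows "(\<integral>\<^sup>+x. ennreal (f x * g x) \<partial>M) \<le> ennreal (a * b)"
\<comment> \<open>The application of Young's inequality below normalises by \<open>a\<close> and
  \<open>b\<close>; if one of them is 0, the product vanishes almost everywhere.\<close>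
proof (cases "a = 0 \<or> b = 0")
  case True
  have "AE x in M. f x * g x = 0"
  proof (cases "a = 0")
    case True
    then have "(\<integral>\<^sup>+x. ennreal (f x powr p) \<partial>M) = 0" using a by simp
    then have "AE x in M. ennreal (f x powr p) = 0" by (subst (asm) nn_integral_0_iff_AE) auto
    then show ?thesis by eventually_elim (simp add: ennreal_eq_0_iff)
  next
    case False
    then have "(\<integral>\<^sup>+x. ennreal (g x powr q) \<partial>M) = 0" using b True by simp
    then have "AE x in M. ennreal (g x powr q) = 0" by (subst (asm) nn_integral_0_iff_AE) auto
    then show ?thesis by eventually_elim (simp add: ennreal_eq_0_iff)
  qed
  then have "(\<integral>\<^sup>+x. ennreal (f x * g x) \<partial>M) = 0" by (subst nn_integral_0_iff_AE) auto
  then show ?thesis by simp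
next
  case False
  then have ab: "a > 0" "b > 0" using a b by auto
  define u where "u = a * b / (p * a powr p)"
  define v where "v = a * b / (q * b powr q)"
  have uv: "u \<ge> 0" "v \<ge> 0" using ab pq by (auto simp: u_def v_def)
  have "(\<integral>\<^sup>+x. ennreal (f x * g x) \<partial>M) \<le> (\<integral>\<^sup>+x. ennreal u * ennreal (f x powr p) + ennreal v * ennreal (g x powr q) \<partial>M)"
  proof (rule nn_integral_mono)
    fix x
    have "f x * g x = a * b * ((f x / a) * (g x / b))" using ab by simp
    also have "\<dots> \<le> a * b * ((f x / a) powr p / p + (g x / b) powr q / q)"
      using ab pq nn by (intro mult_left_mono Youngs_inequality) auto
    also have "\<dots> = u * f x powr p + v * g x powr q"
      using ab pq nn by (simp add: powr_divide u_def v_def field_simps)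
    finally show "ennreal (f x * g x) \<le> ennreal u * ennreal (f x powr p) + ennreal v * ennreal (g x powr q)"
      using uv by (simp add: ennreal_mult'[symmetric] ennreal_plus[symmetric] ennreal_leI del: ennreal_plus)
  qed
  also have "\<dots> = ennreal u * (\<integral>\<^sup>+x. ennreal (f x powr p) \<partial>M) + ennreal v * (\<integral>\<^sup>+x. ennreal (g x powr q) \<partial>M)"
    by (subst nn_integral_add) (auto simp: nn_integral_cmult)
  also have "\<dots> \<le> ennreal u * ennreal (a powr p) + ennreal v * ennreal (b powr q)"
    using a b by (intro add_mono mult_left_mono) auto
  also have "\<dots> = ennreal (u * a powr p + v * b powr q)"
    using uv by (simp add: ennreal_mult'[symmetric] ennreal_plus[symmetric] del: ennreal_plus)
  also have "u * a powr p + v * b powr q = a * b * (1 / p + 1 / q)"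
    using ab pq by (simp add: u_def v_def field_simps)
  finally show ?thesis using pq by simp
qed

lemma Lp_norm_nonneg: "0 \<le> Lp_norm p f"
proof (cases "p = \<infinity>")
  case True
  have "AE x in lebesgue. ereal \<bar>f x\<bar> \<le> esssup lebesgue (\<lambda>x. ereal \<bar>f x\<bar>)"
    by (rule esssup_AE)
  then have "AE x in (lebesgue :: 'a measure). 0 \<le> esssup lebesgue (\<lambda>x. ereal \<bar>f x\<bar>)"
    by eventually_elim (meson abs_ge_zero ereal_less_eq(5) order_trans)
  \<comment> \<open>Lebesgue measure is not trivial, so an inequality between constants that holds
    almost everywhere holds outright.\<close>
  moreover have "\<not> (AE x in (lebesgue :: 'a measure). False)"
    using ae_filter_eq_bot_iff[of "lebesgue :: 'a measure"]
    by (auto simp: trivial_limit_def)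
  ultimately have "0 \<le> esssup lebesgue (\<lambda>x. ereal \<bar>f x\<bar>)"
    by (auto intro: ccontr)
  then show ?thesis using True by (simp add: Lp_norm_def real_of_ereal_pos)
qed (simp add: Lp_norm_def)

lemma in_Lp_infinity_AE_le:
  assumes "in_Lp \<infinity> f"
  shows "AE x in lebesgue. \<bar>f x\<bar> \<le> Lp_norm \<infinity> f"
proof -
  let ?e = "esssup lebesgue (\<lambda>x. ereal \<bar>f x\<bar>)"
  have fin: "?e < \<infinity>" using assms by (simp add: in_Lp_def)
  have "AE x in lebesgue. ereal \<bar>f x\<bar> \<le> ?e" by (rule esssup_AE)
  then show ?thesis
  proof eventually_elim
    case (elim x)
    then have "0 \<le> ?e" by (meson abs_ge_zero ereal_less_eq(5) order_trans)
    then have "?e = ereal (Lp_norm \<infinity> f)" using fin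
      by (cases ?e) (auto simp: Lp_norm_def)
    then show ?case using elim by simp
  qed
qed

text \<open>For finite p this follows from |f| \<le> 1 + |f|^p. It supplies the dominating function
  when cutoffs of \<open>f\<close> are paired with a bounded fractional divergence.\<close>

lemma in_Lp_locally_integrable:
  assumes f: "in_Lp p f" and p: "1 \<le> p" and B: "B \<in> lmeasurable"
  shows "integrable lebesgue (\<lambda>x. f x * indicator B x)"
proof -
  have mf [measurable]: "f \<in> borel_measurable lebesgue" using f by (simp add: in_Lp_def)
  have mB [measurable]: "B \<in> sets lebesgue" using B by (rule fmeasurableD)
  have iB: "integrable lebesgue (\<lambda>x. indicator B x :: real)"
    using B by (simp add: fmeasurable_def)
  show ?thesis
  proof (cases "p = \<infinity>")
    case True
    then have "in_Lp \<infinity> f" using f by simp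
    from in_Lp_infinity_AE_le[OF this]
    have "AE x in lebesgue. norm (f x * indicator B x) \<le> norm (Lp_norm \<infinity> f * indicator B x)"
      by eventually_elim (auto simp: indicator_def)
    then show ?thesis
      by (rule Bochner_Integration.integrable_bound[rotated 2]) (use iB in auto)
  next
    case False
    then obtain t where t: "p = ereal t" "t \<ge> 1" using p by (cases p) auto
    then have int: "integrable lebesgue (\<lambda>x. \<bar>f x\<bar> powr t)" using f by (auto simp: in_Lp_def)
    have "\<bar>f x\<bar> \<le> 1 + \<bar>f x\<bar> powr t" for x
    proof (cases "\<bar>f x\<bar> \<le> 1")
      case True then show ?thesis by (meson add_increasing2 powr_ge_zero)
    next
      case False
      then have "\<bar>f x\<bar> powr 1 \<le> \<bar>f x\<bar> powr t" using t by (intro powr_mono) auto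
      then show ?thesis using False by simp
    qed
    then have "AE x in lebesgue. norm (f x * indicator B x) \<le> norm (indicator B x + \<bar>f x\<bar> powr t)"
      by (intro AE_I2) (auto simp: indicator_def)
    then show ?thesis
      by (rule Bochner_Integration.integrable_bound[rotated 2]) (use iB int in auto)
  qed
qed

lemma gagliardo_ball_weighted:
  fixes \<alpha> q :: real and p :: ereal
  assumes \<alpha>: "\<alpha> > 0" and q: "q \<ge> 1" and \<alpha>q: "\<alpha> * q < 1" and p: "1 < p" and pq: "1 / p + ereal (1 / q) = 1"
  obtains C where "C > 0" "\<And>f s (c :: 'a::euclidean_space). in_Lp p f \<Longrightarrow> s \<ge> 0 \<Longrightarrow>
     (\<integral>\<^sup>+x. ennreal \<bar>f x\<bar> * gagliardo \<alpha> (indicator (ball c s)) x \<partial>lebesgue)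
       \<le> ennreal (C * Lp_norm p f * s powr (real DIM('a) / q - \<alpha>))"
proof -
  define n where "n = real DIM('a)"
  obtain C0 where C0: "C0 > 0" "\<And>s (c::'a). s > 0 \<Longrightarrow>
    (\<integral>\<^sup>+x. ennreal (ball_potential \<alpha> s c x powr q) \<partial>lborel) \<le> ennreal (C0 * s powr (n - \<alpha> * q))"
    using ball_potential_power_integral[OF \<alpha> q \<alpha>q, where 'a='a] unfolding n_def by metis
  \<comment> \<open>The q-th root turns the order n - \<alpha> q of the power integral into n / q -
    \<alpha>.\<close>
  define C where "C = C0 powr (1 / q)"
  have C: "C > 0" using C0 by (simp add: C_def)
  have "(\<integral>\<^sup>+x. ennreal \<bar>f x\<bar> * gagliardo \<alpha> (indicator (ball c s)) x \<partial>lebesgue)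
       \<le> ennreal (C * Lp_norm p f * s powr (n / q - \<alpha>))" if f: "in_Lp p f" and s: "s \<ge> 0" for f :: "'a \<Rightarrow> real" and s c
  proof (cases "s = 0")
    case True
    then show ?thesis by (simp add: gagliardo_def)
  next
    case False
    then have s0: "s > 0" using s by simp
    define M where "M = Lp_norm p f"
    have M: "M \<ge> 0" by (simp add: M_def Lp_norm_nonneg)
    define b where "b = C * s powr (n / q - \<alpha>)"
    have b: "b \<ge> 0" using C by (simp add: b_def)
    have bq: "b powr q = C0 * s powr (n - \<alpha> * q)"
    proof -
      have "(n / q - \<alpha>) * q = n - \<alpha> * q" using q by (simp add: algebra_simps)
      then show ?thesis using C0 C q s0 by (simp add: b_def C_def powr_mult powr_powr)
    qed
    have mf: "f \<in> borel_measurable lebesgue" using f by (simp add: in_Lp_def)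
    \<comment> \<open>A Borel representative of \<open>f\<close>, which is only Lebesgue measurable;
      the integrals can then be taken over \<open>lborel\<close>.\<close>
    obtain g where g [measurable]: "g \<in> borel_measurable lborel" and fg: "AE x in lborel. f x = g x"
      using completion_ex_borel_measurable_real[OF mf] by auto
    let ?P = "ball_potential \<alpha> s c"
    \<comment> \<open>The pointwise bound by \<open>ball_potential\<close> fails to be available
      only on the sphere, a null set.\<close>
    have "sphere c s \<in> null_sets lebesgue"
      using negligible_sphere negligible_iff_null_sets by blast
    then have "AE x in lborel. x \<notin> sphere c s"
      by (intro AE_not_in) (simp add: null_sets_completion_iff)
    then have sph: "AE x in lborel. norm (x - c) \<noteq> s"
      by eventually_elim (simp add: dist_norm norm_minus_commute)
    have "(\<integral>\<^sup>+x. ennreal \<bar>f x\<bar> * gagliardo \<alpha> (indicator (ball c s)) x \<partial>lebesgue)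
       = (\<integral>\<^sup>+x. ennreal \<bar>f x\<bar> * gagliardo \<alpha> (indicator (ball c s)) x \<partial>lborel)"
      by (rule nn_integral_completion)
    also have "\<dots> \<le> (\<integral>\<^sup>+x. ennreal (\<bar>g x\<bar> * ?P x) \<partial>lborel)"
    proof (rule nn_integral_mono_AE)
      show "AE x in lborel. ennreal \<bar>f x\<bar> * gagliardo \<alpha> (indicator (ball c s)) x \<le> ennreal (\<bar>g x\<bar> * ?P x)"
        using fg sph
        by eventually_elim (use gagliardo_ball_le[OF \<alpha> s0] in \<open>auto simp: ennreal_mult' intro!: mult_left_mono\<close>)
    qed
    also have "\<dots> \<le> ennreal (M * b)"
    proof (cases "p = \<infinity>")
      case True
      have q1: "q = 1" using pq True by (simp add: one_ereal_def)
      have "AE x in lborel. \<bar>f x\<bar> \<le> M"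
        using in_Lp_infinity_AE_le[of f] f True by (simp add: M_def AE_completion_iff)
      then have "AE x in lborel. \<bar>g x\<bar> \<le> M" using fg by eventually_elim simp
      then have "(\<integral>\<^sup>+x. ennreal (\<bar>g x\<bar> * ?P x) \<partial>lborel) \<le> (\<integral>\<^sup>+x. ennreal M * ennreal (?P x powr q) \<partial>lborel)"
      proof (intro nn_integral_mono_AE, eventually_elim)
        case (elim x)
        then show ?case using ball_potential_nonneg[OF \<alpha> s0, of c x] M
          by (auto simp: q1 ennreal_mult'[symmetric] intro!: ennreal_leI mult_right_mono)
      qed
      also have "\<dots> = ennreal M * (\<integral>\<^sup>+x. ennreal (?P x powr q) \<partial>lborel)"
        by (rule nn_integral_cmult) simp
      also have "\<dots> \<le> ennreal M * ennreal (b powr q)"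
        unfolding bq by (intro mult_left_mono C0(2) s0) auto
      also have "\<dots> = ennreal (M * b)" using M b by (simp add: q1 ennreal_mult'[symmetric])
      finally show ?thesis .
    next
      case False
      then obtain t where t: "p = ereal t" "t > 1" using p by (cases p) auto
      have tq: "1 / t + 1 / q = 1" using pq t by (simp add: one_ereal_def)
      then have "q > 1" using t q by (cases "q = 1") auto
      show ?thesis
      proof (rule nn_integral_Holder[OF _ _ _ _ \<open>t > 1\<close> \<open>q > 1\<close> tq M _ b])
        have int: "integrable lebesgue (\<lambda>x. \<bar>f x\<bar> powr t)" using f t by (auto simp: in_Lp_def)
        have "(\<integral>\<^sup>+x. ennreal (\<bar>g x\<bar> powr t) \<partial>lborel) = (\<integral>\<^sup>+x. ennreal (\<bar>f x\<bar> powr t) \<partial>lborel)"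
          by (rule nn_integral_cong_AE) (use fg in eventually_elim, simp)
        also have "\<dots> = (\<integral>\<^sup>+x. ennreal (\<bar>f x\<bar> powr t) \<partial>lebesgue)" by (simp add: nn_integral_completion)
        also have "\<dots> = ennreal (\<integral>x. \<bar>f x\<bar> powr t \<partial>lebesgue)"
          using int by (intro nn_integral_eq_integral) auto
        also have "(\<integral>x. \<bar>f x\<bar> powr t \<partial>lebesgue) = M powr t"
          using t by (simp add: M_def Lp_norm_def powr_powr)
        finally show "(\<integral>\<^sup>+x. ennreal (\<bar>g x\<bar> powr t) \<partial>lborel) \<le> ennreal (M powr t)" by simp
        show "(\<integral>\<^sup>+x. ennreal (?P x powr q) \<partial>lborel) \<le> ennreal (b powr q)"
          unfolding bq by (rule C0(2)[OF s0])
      qed (use ball_potential_nonneg[OF \<alpha> s0, of c] in auto)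
    qed
    finally show ?thesis by (simp add: M_def b_def mult_ac)
  qed
  then show ?thesis using that[of C] C by (auto simp: n_def)
qed

section \<open>From balls to smooth cutoffs by the layer-cake formula\<close>

lemma abs_diff_layer_cake:
  fixes a b :: real
  assumes "0 \<le> a" "a \<le> 1" "0 \<le> b" "b \<le> 1"
  shows "ennreal \<bar>a - b\<bar> =
    (\<integral>\<^sup>+t. ennreal \<bar>indicator {..<a} t - indicator {..<b} t\<bar> * indicator {0..<1} t \<partial>lborel)"
proof -
  have "(\<integral>\<^sup>+t. ennreal \<bar>indicator {..<a} t - indicator {..<b} t\<bar> * indicator {0..<1} t \<partial>lborel)
    = (\<integral>\<^sup>+t. indicator {min a b..<max a b} t \<partial>lborel)"
    using assms by (intro nn_integral_cong) (auto simp: indicator_def)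
  also have "\<dots> = ennreal \<bar>a - b\<bar>" by (auto simp: min_def max_def)
  finally show ?thesis ..
qed

text \<open>A coarea formula: the potential of \<eta> is the integral over t in [0,1) of the
  potentials of its superlevel sets. Since [0,1) has length 1, a common bound for the levels passes
  to \<eta> with the same constant and without any derivative of \<eta>.\<close>

lemma gagliardo_cutoff_weighted:
  fixes c :: "'a::euclidean_space" and f \<eta> :: "'a \<Rightarrow> real"
  assumes f: "f \<in> borel_measurable lebesgue" and \<eta> [measurable]: "\<eta> \<in> borel_measurable borel"
    and bd: "\<And>y. 0 \<le> \<eta> y" "\<And>y. \<eta> y \<le> 1"
    and level: "\<And>t. 0 \<le> t \<Longrightarrow> t < 1 \<Longrightarrow>
      (\<integral>\<^sup>+x. ennreal \<bar>f x\<bar> * gagliardo \<alpha> (indicator {y. t < \<eta> y}) x \<partial>lebesgue) \<le> K"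
  shows "(\<integral>\<^sup>+x. ennreal \<bar>f x\<bar> * gagliardo \<alpha> \<eta> x \<partial>lebesgue) \<le> K"
proof -
  obtain g where g [measurable]: "g \<in> borel_measurable lborel" and fg: "AE x in lborel. f x = g x"
    using completion_ex_borel_measurable_real[OF f] by auto
  have g' [measurable]: "g \<in> borel_measurable borel" using g by simp
  define \<kappa> where "\<kappa> x y = norm (y - x) powr - (real DIM('a) + \<alpha>)" for x y :: 'a
  define \<psi> where "\<psi> t x y = ennreal (\<bar>indicator {..<\<eta> y} t - indicator {..<\<eta> x} t\<bar> * \<kappa> x y)" for t x y
  define H where "H t x = (\<integral>\<^sup>+y. \<psi> t x y \<partial>lborel)" for t x
  \<comment> \<open>Written with comparisons instead of indicators of moving sets, the integrand is
    visibly measurable jointly in t, x and y, as the two applications of Tonelli require.\<close>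
  have \<psi>_alt: "\<psi> t x y = ennreal (\<bar>(if t < \<eta> y then 1 else 0) - (if t < \<eta> x then 1 else 0)\<bar> * \<kappa> x y)" for t x y
    by (simp add: \<psi>_def indicator_def)
  have ind [measurable (raw)]: "(\<lambda>z. indicator {0..<1::real} (F z) :: ennreal) \<in> borel_measurable N"
    if "F \<in> borel_measurable N" for F and N :: "'c measure"
    using measurable_compose[OF that borel_measurable_indicator[of "{0..<1::real}" borel]] by simp
  have \<psi> [measurable (raw)]: "(\<lambda>z. \<psi> (F z) (G z) (Q z)) \<in> borel_measurable N"
    if [measurable]: "F \<in> borel_measurable N" "G \<in> borel_measurable N" "Q \<in> borel_measurable N"
    for F G Q and N :: "'c measure"
    unfolding \<psi>_alt \<kappa>_def by measurable
  have H_pair: "(\<lambda>z. H (fst z) (snd z)) \<in> borel_measurable (borel \<Otimes>\<^sub>M borel)"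
    unfolding H_def by measurable
  have H [measurable (raw)]: "(\<lambda>z. H (F z) (G z)) \<in> borel_measurable N"
    if [measurable]: "F \<in> borel_measurable N" "G \<in> borel_measurable N" for F G and N :: "'c measure"
  proof -
    have "(\<lambda>z. (F z, G z)) \<in> N \<rightarrow>\<^sub>M borel \<Otimes>\<^sub>M borel" by measurable
    from measurable_compose[OF this H_pair] show ?thesis by simp
  qed
  have swap: "(\<integral>\<^sup>+x. ennreal \<bar>f x\<bar> * h x \<partial>lebesgue) = (\<integral>\<^sup>+x. ennreal \<bar>g x\<bar> * h x \<partial>lborel)" for h
  proof -
    have "(\<integral>\<^sup>+x. ennreal \<bar>f x\<bar> * h x \<partial>lborel) = (\<integral>\<^sup>+x. ennreal \<bar>g x\<bar> * h x \<partial>lborel)"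
      by (rule nn_integral_cong_AE) (use fg in eventually_elim, simp)
    then show ?thesis by (simp add: nn_integral_completion)
  qed
  have gag: "gagliardo \<alpha> \<eta> x = (\<integral>\<^sup>+t. H t x * indicator {0..<1} t \<partial>lborel)" for x
  proof -
    have "gagliardo \<alpha> \<eta> x = (\<integral>\<^sup>+y. (\<integral>\<^sup>+t. \<psi> t x y * indicator {0..<1} t \<partial>lborel) \<partial>lborel)"
      unfolding gagliardo_def
    proof (rule nn_integral_cong)
      fix y
      have "ennreal (\<bar>\<eta> y - \<eta> x\<bar> * \<kappa> x y) = ennreal \<bar>\<eta> y - \<eta> x\<bar> * ennreal (\<kappa> x y)"
        by (simp add: ennreal_mult' \<kappa>_def)
      also have "\<dots> = (\<integral>\<^sup>+t. ennreal \<bar>indicator {..<\<eta> y} t - indicator {..<\<eta> x} t\<bar> * indicator {0..<1} t \<partial>lborel) * ennreal (\<kappa> x y)"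
        by (subst abs_diff_layer_cake) (auto simp: bd)
      also have "\<dots> = (\<integral>\<^sup>+t. ennreal \<bar>indicator {..<\<eta> y} t - indicator {..<\<eta> x} t\<bar> * indicator {0..<1} t * ennreal (\<kappa> x y) \<partial>lborel)"
        by (rule nn_integral_multc[symmetric]) measurable
      also have "\<dots> = (\<integral>\<^sup>+t. \<psi> t x y * indicator {0..<1} t \<partial>lborel)"
        by (intro nn_integral_cong) (simp add: \<psi>_def ennreal_mult' mult_ac \<kappa>_def)
      finally show "ennreal (\<bar>\<eta> y - \<eta> x\<bar> * norm (y - x) powr - (real DIM('a) + \<alpha>)) =
        (\<integral>\<^sup>+t. \<psi> t x y * indicator {0..<1} t \<partial>lborel)" by (simp add: \<kappa>_def)
    qed
    also have "\<dots> = (\<integral>\<^sup>+t. (\<integral>\<^sup>+y. \<psi> t x y * indicator {0..<1} t \<partial>lborel) \<partial>lborel)"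
      by (rule lborel_pair.Fubini') measurable
    also have "\<dots> = (\<integral>\<^sup>+t. H t x * indicator {0..<1} t \<partial>lborel)"
      unfolding H_def by (intro nn_integral_cong nn_integral_multc) measurable
    finally show ?thesis .
  qed
  have "(\<integral>\<^sup>+x. ennreal \<bar>f x\<bar> * gagliardo \<alpha> \<eta> x \<partial>lebesgue)
     = (\<integral>\<^sup>+x. (\<integral>\<^sup>+t. ennreal \<bar>g x\<bar> * (H t x * indicator {0..<1} t) \<partial>lborel) \<partial>lborel)"
    unfolding swap gag by (intro nn_integral_cong nn_integral_cmult[symmetric]) measurable
  also have "\<dots> = (\<integral>\<^sup>+t. (\<integral>\<^sup>+x. ennreal \<bar>g x\<bar> * (H t x * indicator {0..<1} t) \<partial>lborel) \<partial>lborel)"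
    by (rule lborel_pair.Fubini') measurable
  also have "\<dots> \<le> (\<integral>\<^sup>+t. K * indicator {0..<1::real} t \<partial>lborel)"
  proof (rule nn_integral_mono)
    fix t :: real
    show "(\<integral>\<^sup>+x. ennreal \<bar>g x\<bar> * (H t x * indicator {0..<1} t) \<partial>lborel) \<le> K * indicator {0..<1} t"
    proof (cases "t \<in> {0..<1}")
      case True
      have "H t x = gagliardo \<alpha> (indicator {y. t < \<eta> y}) x" for x
        by (simp add: H_def \<psi>_def gagliardo_def \<kappa>_def indicator_def)
      then show ?thesis using level[of t] True unfolding swap by simp
    qed simp
  qed
  also have "\<dots> = K" by (simp add: nn_integral_cmult_indicator)
  finally show ?thesis .
qed

section \<open>The fractional divergence\<close>

text \<open>Keeping the increment as a separate argument \<open>v\<close>, in which the kernel is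
  linear, reduces the product rule to algebra on increments.\<close>

definition div_kernel :: "real \<Rightarrow> 'a::euclidean_space \<Rightarrow> 'a \<Rightarrow> 'a \<Rightarrow> real" where
  "div_kernel \<alpha> x y v = ((y - x) \<bullet> v) / norm (y - x) powr (real DIM('a) + \<alpha> + 1)"

lemma abs_div_kernel_le:
  fixes x y v :: "'a::euclidean_space"
  shows "\<bar>div_kernel \<alpha> x y v\<bar> \<le> norm v * norm (y - x) powr - (real DIM('a) + \<alpha>)"
proof (cases "y = x")
  case False
  define t where "t = norm (y - x)"
  have t: "t > 0" using False by (simp add: t_def)
  have "\<bar>div_kernel \<alpha> x y v\<bar> \<le> (t * norm v) / t powr (real DIM('a) + \<alpha> + 1)"
    using Cauchy_Schwarz_ineq2[of "y - x" v] t
    by (simp add: div_kernel_def t_def[symmetric] abs_mult divide_right_mono)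
  also have "\<dots> = norm v * (t powr 1 * t powr - (real DIM('a) + \<alpha> + 1))"
  proof -
    have "(t * norm v) / t powr g = norm v * (t powr 1 * t powr - g)" for g
      using t by (simp add: powr_minus divide_inverse)
    then show ?thesis .
  qed
  also have "t powr 1 * t powr - (real DIM('a) + \<alpha> + 1) = t powr - (real DIM('a) + \<alpha>)"
    unfolding powr_add[symmetric] by simp
  finally show ?thesis by (simp add: t_def)
qed (simp add: div_kernel_def)

lemma div_kernel_diff: "div_kernel \<alpha> x y (v - u) = div_kernel \<alpha> x y v - div_kernel \<alpha> x y u"
  by (simp add: div_kernel_def inner_diff_right diff_divide_distrib)

lemma div_kernel_scaleR: "div_kernel \<alpha> x y (a *\<^sub>R v) = a * div_kernel \<alpha> x y v"
  by (simp add: div_kernel_def)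

lemma borel_measurable_div_kernel [measurable (raw)]:
  fixes F G V :: "'c \<Rightarrow> 'a::euclidean_space"
  assumes [measurable]: "F \<in> borel_measurable N" "G \<in> borel_measurable N" "V \<in> borel_measurable N"
  shows "(\<lambda>z. div_kernel \<alpha> (F z) (G z) (V z)) \<in> borel_measurable N"
  unfolding div_kernel_def by measurable

lemma test_field_measurable: "test_field \<phi> \<Longrightarrow> \<phi> \<in> borel_measurable borel"
  by (simp add: test_field_def smooth_map_measurable)

lemma frac_div_eq:
  fixes \<phi> :: "'a::euclidean_space \<Rightarrow> 'a"
  assumes [measurable]: "\<phi> \<in> borel_measurable borel"
  shows "frac_div \<alpha> \<phi> x = mu_const DIM('a) \<alpha> * (\<integral>y. div_kernel \<alpha> x y (\<phi> y - \<phi> x) \<partial>lborel)"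
  unfolding frac_div_def div_kernel_def by (subst integral_completion) auto

lemma borel_measurable_frac_div:
  fixes \<phi> :: "'a::euclidean_space \<Rightarrow> 'a"
  assumes [measurable]: "\<phi> \<in> borel_measurable borel"
  shows "frac_div \<alpha> \<phi> \<in> borel_measurable borel"
proof -
  have "(\<lambda>x. \<integral>y. div_kernel \<alpha> x y (\<phi> y - \<phi> x) \<partial>lborel) \<in> borel_measurable borel"
    by measurable
  then show ?thesis unfolding frac_div_eq[OF assms, abs_def] by measurable
qed

text \<open>Within distance 1 the Lipschitz bound lowers the singularity to order n + \<alpha> - 1 <
  n; beyond it, boundedness suffices because n + \<alpha> > n. Translation invariance makes the
  bound uniform in x.\<close>

lemma div_kernel_test_field_bound:
  fixes \<phi> :: "'a::euclidean_space \<Rightarrow> 'a"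
  assumes \<phi>: "test_field \<phi>" and \<alpha>: "0 < \<alpha>" "\<alpha> < 1"
  obtains C where "C \<ge> 0" "\<And>x. (\<integral>\<^sup>+y. ennreal \<bar>div_kernel \<alpha> x y (\<phi> y - \<phi> x)\<bar> \<partial>lborel) \<le> ennreal C"
proof -
  let ?n = "real DIM('a)"
  obtain B where B: "B \<ge> 0" "\<And>x. norm (\<phi> x) \<le> B" using test_field_bounded[OF \<phi>] by metis
  obtain L where L: "L \<ge> 0" "\<And>x y. norm (\<phi> y - \<phi> x) \<le> L * norm (y - x)" using test_field_Lipschitz[OF \<phi>] by metis
  let ?I = "\<lambda>x y. ennreal (norm (y - x) powr - (?n + \<alpha> - 1)) * indicator {0..1} (norm (y - x))"
  let ?O = "\<lambda>x y. ennreal (norm (y - x) powr - (?n + \<alpha>)) * indicator {1..} (norm (y - x))"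
  define K where "K = ennreal L * (\<integral>\<^sup>+y. ?I (0::'a) y \<partial>lborel) + ennreal (2 * B) * (\<integral>\<^sup>+y. ?O (0::'a) y \<partial>lborel)"
  have "(\<integral>\<^sup>+y. ?I (0::'a) y \<partial>lborel) < \<infinity>" by (rule nn_integral_norm_powr_inside) (use \<alpha> in simp)
  moreover have "(\<integral>\<^sup>+y. ?O (0::'a) y \<partial>lborel) < \<infinity>"
    using nn_integral_norm_powr_outside[of 1 "?n + \<alpha>" "0::'a"] \<alpha> by simp
  ultimately have K: "K < \<infinity>" by (simp add: K_def ennreal_mult_less_top)
  have "(\<integral>\<^sup>+y. ennreal \<bar>div_kernel \<alpha> x y (\<phi> y - \<phi> x)\<bar> \<partial>lborel) \<le> K" for x
  proof -
    have "(\<integral>\<^sup>+y. ennreal \<bar>div_kernel \<alpha> x y (\<phi> y - \<phi> x)\<bar> \<partial>lborel)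
       \<le> (\<integral>\<^sup>+y. ennreal L * ?I x y + ennreal (2 * B) * ?O x y \<partial>lborel)"
    proof (rule nn_integral_mono)
      fix y
      define t where "t = norm (y - x)"
      note k = abs_div_kernel_le[of \<alpha> x y "\<phi> y - \<phi> x", folded t_def]
      show "ennreal \<bar>div_kernel \<alpha> x y (\<phi> y - \<phi> x)\<bar> \<le> ennreal L * ?I x y + ennreal (2 * B) * ?O x y"
      proof (cases "t \<le> 1")
        case True
        have "norm (\<phi> y - \<phi> x) * t powr - (?n + \<alpha>) \<le> (L * t) * t powr - (?n + \<alpha>)"
          using L(2)[of y x] by (intro mult_right_mono) (auto simp: t_def)
        also have "t * t powr - (?n + \<alpha>) = t powr - (?n + \<alpha> - 1)"
          \<comment> \<open>At \<open>t = 0\<close> both sides vanish, since 0 raised to any power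
            by \<open>powr\<close> is 0.\<close>
          by (cases "t = 0") (auto simp: t_def powr_mult_base algebra_simps)
        then have "(L * t) * t powr - (?n + \<alpha>) = L * t powr - (?n + \<alpha> - 1)" by (simp add: mult.assoc)
        finally have "ennreal \<bar>div_kernel \<alpha> x y (\<phi> y - \<phi> x)\<bar> \<le> ennreal L * ?I x y"
          using k L(1) True by (simp add: t_def ennreal_mult'[symmetric] ennreal_leI)
        then show ?thesis by (meson add_increasing2 zero_le order_trans le_add_same_cancel1)
      next
        case False
        have "norm (\<phi> y - \<phi> x) \<le> 2 * B" using norm_triangle_ineq4[of "\<phi> y" "\<phi> x"] B(2)[of x] B(2)[of y] by linarith
        then have "norm (\<phi> y - \<phi> x) * t powr - (?n + \<alpha>) \<le> 2 * B * t powr - (?n + \<alpha>)"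
          by (intro mult_right_mono) auto
        then have "ennreal \<bar>div_kernel \<alpha> x y (\<phi> y - \<phi> x)\<bar> \<le> ennreal (2 * B) * ?O x y"
          using k B(1) False by (simp add: t_def ennreal_mult'[symmetric] ennreal_leI)
        then show ?thesis by (simp add: add_increasing)
      qed
    qed
    also have "\<dots> = ennreal L * (\<integral>\<^sup>+y. ?I x y \<partial>lborel) + ennreal (2 * B) * (\<integral>\<^sup>+y. ?O x y \<partial>lborel)"
      by (subst nn_integral_add) (auto simp: nn_integral_cmult)
    also have "\<dots> = K"
      using nn_integral_lborel_translate[of "?I 0" x] nn_integral_lborel_translate[of "?O 0" x]
      by (simp add: K_def)
    finally show ?thesis .
  qed
  moreover have "K = ennreal (enn2real K)" using K by simp
  ultimately show ?thesis using that[of "enn2real K"] by (metis enn2real_nonneg)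
qed

lemma integrable_div_kernel:
  fixes \<phi> :: "'a::euclidean_space \<Rightarrow> 'a"
  assumes \<phi>: "test_field \<phi>" and \<alpha>: "0 < \<alpha>" "\<alpha> < 1"
  shows "integrable lborel (\<lambda>y. div_kernel \<alpha> x y (\<phi> y - \<phi> x))"
proof -
  note [measurable] = test_field_measurable[OF \<phi>]
  obtain C where "\<And>x. (\<integral>\<^sup>+y. ennreal \<bar>div_kernel \<alpha> x y (\<phi> y - \<phi> x)\<bar> \<partial>lborel) \<le> ennreal C"
    using div_kernel_test_field_bound[OF assms] by metis
  then show ?thesis
    by (auto simp: integrable_iff_bounded intro: le_less_trans[OF _ ennreal_less_top])
qed

lemma frac_div_bounded:
  fixes \<phi> :: "'a::euclidean_space \<Rightarrow> 'a"
  assumes \<phi>: "test_field \<phi>" and \<alpha>: "0 < \<alpha>" "\<alpha> < 1"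
  obtains C where "\<And>x. \<bar>frac_div \<alpha> \<phi> x\<bar> \<le> C"
proof -
  obtain C where C: "C \<ge> 0" "\<And>x. (\<integral>\<^sup>+y. ennreal \<bar>div_kernel \<alpha> x y (\<phi> y - \<phi> x)\<bar> \<partial>lborel) \<le> ennreal C"
    using div_kernel_test_field_bound[OF assms] by metis
  have "\<bar>\<integral>y. div_kernel \<alpha> x y (\<phi> y - \<phi> x) \<partial>lborel\<bar> \<le> C" for x
  proof -
    have "ennreal (norm (\<integral>y. div_kernel \<alpha> x y (\<phi> y - \<phi> x) \<partial>lborel)) \<le> ennreal C"
      using integral_norm_bound_ennreal[OF integrable_div_kernel[OF assms, of x]] C(2)[of x]
      by (simp add: order_trans)
    then show ?thesis using C(1) by simp
  qed
  then have "\<bar>frac_div \<alpha> \<phi> x\<bar> \<le> \<bar>mu_const DIM('a) \<alpha>\<bar> * C" for x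
    unfolding frac_div_eq[OF test_field_measurable[OF \<phi>]] by (auto simp: abs_mult intro!: mult_left_mono)
  then show ?thesis using that by blast
qed

text \<open>Here \<phi> is any bounded Borel field, not necessarily a test field, so that the bound
  covers constant fields as well as the commutator with a test field.\<close>

lemma abs_integral_div_kernel_le:
  fixes \<phi> :: "'a::euclidean_space \<Rightarrow> 'a" and \<eta> :: "'a \<Rightarrow> real"
  assumes [measurable]: "\<phi> \<in> borel_measurable borel" "\<eta> \<in> borel_measurable borel"
    and bd: "\<And>y. norm (\<phi> y) \<le> b"
    and int: "integrable lborel (\<lambda>y. div_kernel \<alpha> x y ((\<eta> y - \<eta> x) *\<^sub>R \<phi> y))"
  shows "ennreal \<bar>m * (\<integral>y. div_kernel \<alpha> x y ((\<eta> y - \<eta> x) *\<^sub>R \<phi> y) \<partial>lborel)\<bar>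
     \<le> ennreal (\<bar>m\<bar> * b) * gagliardo \<alpha> \<eta> x"
proof -
  have b: "b \<ge> 0" using bd[of 0] norm_ge_zero order_trans by blast
  have "ennreal (norm (\<integral>y. div_kernel \<alpha> x y ((\<eta> y - \<eta> x) *\<^sub>R \<phi> y) \<partial>lborel))
     \<le> (\<integral>\<^sup>+y. norm (div_kernel \<alpha> x y ((\<eta> y - \<eta> x) *\<^sub>R \<phi> y)) \<partial>lborel)"
    by (rule integral_norm_bound_ennreal[OF int])
  also have "\<dots> \<le> (\<integral>\<^sup>+y. ennreal b * ennreal (\<bar>\<eta> y - \<eta> x\<bar> * norm (y - x) powr - (real DIM('a) + \<alpha>)) \<partial>lborel)"
  proof (rule nn_integral_mono)
    fix y
    have "norm (div_kernel \<alpha> x y ((\<eta> y - \<eta> x) *\<^sub>R \<phi> y))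
        \<le> norm ((\<eta> y - \<eta> x) *\<^sub>R \<phi> y) * norm (y - x) powr - (real DIM('a) + \<alpha>)"
      using abs_div_kernel_le[of \<alpha> x y "(\<eta> y - \<eta> x) *\<^sub>R \<phi> y"] by simp
    also have "\<dots> \<le> (\<bar>\<eta> y - \<eta> x\<bar> * b) * norm (y - x) powr - (real DIM('a) + \<alpha>)"
      using bd by (intro mult_right_mono) (auto intro: mult_left_mono)
    finally show "ennreal (norm (div_kernel \<alpha> x y ((\<eta> y - \<eta> x) *\<^sub>R \<phi> y)))
      \<le> ennreal b * ennreal (\<bar>\<eta> y - \<eta> x\<bar> * norm (y - x) powr - (real DIM('a) + \<alpha>))"
      using b by (simp add: ennreal_mult'[symmetric] mult_ac ennreal_leI)
  qed
  also have "\<dots> = ennreal b * gagliardo \<alpha> \<eta> x"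
    unfolding gagliardo_def by (rule nn_integral_cmult) measurable
  finally have "ennreal \<bar>\<integral>y. div_kernel \<alpha> x y ((\<eta> y - \<eta> x) *\<^sub>R \<phi> y) \<partial>lborel\<bar> \<le> ennreal b * gagliardo \<alpha> \<eta> x" by simp
  then have "ennreal \<bar>m\<bar> * ennreal \<bar>\<integral>y. div_kernel \<alpha> x y ((\<eta> y - \<eta> x) *\<^sub>R \<phi> y) \<partial>lborel\<bar>
     \<le> ennreal \<bar>m\<bar> * (ennreal b * gagliardo \<alpha> \<eta> x)" by (rule mult_left_mono) simp
  then show ?thesis using b by (simp add: ennreal_mult' abs_mult mult.assoc)
qed

text \<open>Split
  \<eta> y \<phi> y - \<eta> x \<phi> x = \<eta> x (\<phi> y - \<phi> x) + (\<eta> y - \<eta> x) \<phi> y.\<close>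
lemma frac_div_commutator:
  fixes \<phi> :: "'a::euclidean_space \<Rightarrow> 'a" and \<eta> :: "'a \<Rightarrow> real"
  assumes \<phi>: "test_field \<phi>" and \<eta>: "smooth_map \<eta>" and \<alpha>: "0 < \<alpha>" "\<alpha> < 1"
    and bd: "\<And>y. norm (\<phi> y) \<le> b"
  shows "ennreal \<bar>frac_div \<alpha> (\<lambda>y. \<eta> y *\<^sub>R \<phi> y) x - \<eta> x * frac_div \<alpha> \<phi> x\<bar>
    \<le> ennreal (\<bar>mu_const DIM('a) \<alpha>\<bar> * b) * gagliardo \<alpha> \<eta> x"
proof -
  note m\<phi> [measurable] = test_field_measurable[OF \<phi>]
  have m\<eta> [measurable]: "\<eta> \<in> borel_measurable borel"
    by (rule smooth_map_measurable[OF \<eta>])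
  have tf: "test_field (\<lambda>y. \<eta> y *\<^sub>R \<phi> y)" by (rule test_field_cutoff[OF \<eta> \<phi>])
  note i1 = integrable_div_kernel[OF tf \<alpha>, of x] and i2 = integrable_div_kernel[OF \<phi> \<alpha>, of x]
  have eq: "div_kernel \<alpha> x y ((\<eta> y - \<eta> x) *\<^sub>R \<phi> y) =
     div_kernel \<alpha> x y (\<eta> y *\<^sub>R \<phi> y - \<eta> x *\<^sub>R \<phi> x) - \<eta> x * div_kernel \<alpha> x y (\<phi> y - \<phi> x)" for y
    by (simp add: div_kernel_diff div_kernel_scaleR algebra_simps)
  have int: "integrable lborel (\<lambda>y. div_kernel \<alpha> x y ((\<eta> y - \<eta> x) *\<^sub>R \<phi> y))"
    unfolding eq by (intro Bochner_Integration.integrable_diff integrable_mult_right i1 i2)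
  have "frac_div \<alpha> (\<lambda>y. \<eta> y *\<^sub>R \<phi> y) x - \<eta> x * frac_div \<alpha> \<phi> x
     = mu_const DIM('a) \<alpha> * (\<integral>y. div_kernel \<alpha> x y ((\<eta> y - \<eta> x) *\<^sub>R \<phi> y) \<partial>lborel)"
    unfolding frac_div_eq[OF m\<phi>] frac_div_eq[OF test_field_measurable[OF tf]] eq
    using i1 i2 by (subst Bochner_Integration.integral_diff) (auto simp: algebra_simps)
  then show ?thesis using abs_integral_div_kernel_le[OF m\<phi> m\<eta> bd int] by simp
qed

text \<open>For a constant field the increments of the product are (\<eta> y - \<eta> x) e, so the
  whole divergence is of commutator type. Testing with such fields bounds the components of the
  fractional gradient on balls.\<close>

lemma frac_div_cutoff_const:
  fixes e :: "'a::euclidean_space"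
  assumes tf: "test_field (\<lambda>y. \<eta> y *\<^sub>R e)" and [measurable]: "\<eta> \<in> borel_measurable borel"
    and \<alpha>: "0 < \<alpha>" "\<alpha> < 1"
  shows "ennreal \<bar>frac_div \<alpha> (\<lambda>y. \<eta> y *\<^sub>R e) x\<bar>
    \<le> ennreal (\<bar>mu_const DIM('a) \<alpha>\<bar> * norm e) * gagliardo \<alpha> \<eta> x"
  using abs_integral_div_kernel_le[of "\<lambda>_. e" \<eta> "norm e" \<alpha> x "mu_const DIM('a) \<alpha>"]
    integrable_div_kernel[OF tf \<alpha>, of x]
  unfolding frac_div_eq[OF test_field_measurable[OF tf]]
  by (simp add: scaleR_diff_left)

text \<open>If f is not integrable, the integral on the left is 0 by default.\<close>

lemma ennreal_abs_integral_le:
  fixes f :: "'a \<Rightarrow> real"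
  shows "ennreal \<bar>\<integral>x. f x \<partial>M\<bar> \<le> (\<integral>\<^sup>+x. ennreal \<bar>f x\<bar> \<partial>M)"
  using integral_norm_bound_ennreal[of M f] by (cases "integrable M f") (auto simp: not_integrable_integral_eq)

lemma weighted_integral_bound:
  fixes f g :: "'a::euclidean_space \<Rightarrow> real"
  assumes bound: "\<And>x. ennreal \<bar>g x\<bar> \<le> ennreal a * G x" and a: "a \<ge> 0" and K: "K \<ge> 0"
    and G: "(\<integral>\<^sup>+x. ennreal \<bar>f x\<bar> * G x \<partial>lebesgue) \<le> ennreal K"
    and [measurable]: "f \<in> borel_measurable lebesgue" "g \<in> borel_measurable lebesgue"
  shows "integrable lebesgue (\<lambda>x. f x * g x)" "\<bar>\<integral>x. f x * g x \<partial>lebesgue\<bar> \<le> a * K"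
proof -
  have "(\<integral>\<^sup>+x. ennreal \<bar>f x * g x\<bar> \<partial>lebesgue) \<le> ennreal (a * K)"
  proof (cases "a = 0")
    case True
    then have "g x = 0" for x using bound[of x] by (simp add: ennreal_eq_0_iff)
    then show ?thesis by simp
  next
    case False
    then have a': "1 / a > 0" using a by simp
    \<comment> \<open>The factor \<open>a\<close> is pulled out of the integral of the measurable
      product f g, because \<open>G\<close> carries no measurability assumption.\<close>
    have "(\<integral>\<^sup>+x. ennreal \<bar>f x * g x\<bar> \<partial>lebesgue) = (\<integral>\<^sup>+x. ennreal a * (ennreal (1 / a) * ennreal \<bar>f x * g x\<bar>) \<partial>lebesgue)"
      using False a by (intro nn_integral_cong) (simp add: ennreal_mult'[symmetric])
    also have "\<dots> = ennreal a * (\<integral>\<^sup>+x. ennreal (1 / a) * ennreal \<bar>f x * g x\<bar> \<partial>lebesgue)"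
      by (rule nn_integral_cmult) measurable
    also have "\<dots> \<le> ennreal a * (\<integral>\<^sup>+x. ennreal \<bar>f x\<bar> * G x \<partial>lebesgue)"
    proof (intro mult_left_mono nn_integral_mono)
      fix x
      have "ennreal (1 / a) * ennreal \<bar>f x * g x\<bar> = ennreal \<bar>f x\<bar> * (ennreal (1 / a) * ennreal \<bar>g x\<bar>)"
        using a' by (simp add: ennreal_mult'[symmetric] abs_mult mult_ac)
      also have "\<dots> \<le> ennreal \<bar>f x\<bar> * (ennreal (1 / a) * (ennreal a * G x))"
        by (intro mult_left_mono bound) auto
      also have "ennreal (1 / a) * (ennreal a * G x) = G x"
        using False a by (simp add: mult.assoc[symmetric] ennreal_mult'[symmetric])
      finally show "ennreal (1 / a) * ennreal \<bar>f x * g x\<bar> \<le> ennreal \<bar>f x\<bar> * G x" .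
    qed simp
    also have "\<dots> \<le> ennreal a * ennreal K" by (intro mult_left_mono G) simp
    finally show ?thesis using a K by (simp add: ennreal_mult')
  qed
  then show "integrable lebesgue (\<lambda>x. f x * g x)"
    by (auto simp: integrable_iff_bounded intro: le_less_trans)
  have "ennreal \<bar>\<integral>x. f x * g x \<partial>lebesgue\<bar> \<le> ennreal (a * K)"
    using ennreal_abs_integral_le \<open>_ \<le> ennreal (a * K)\<close> by (rule order_trans)
  then show "\<bar>\<integral>x. f x * g x \<partial>lebesgue\<bar> \<le> a * K" using a K by simp
qed

lemma borel_measurable_ball_cutoff [measurable]: "ball_cutoff c r k \<in> borel_measurable borel"
  by (rule smooth_map_measurable[OF smooth_ball_cutoff])

section \<open>Integration by parts localised to one ball\<close>

lemma frac_grad_polar_AE_le: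
  assumes "frac_grad_polar \<alpha> f \<mu> \<nu>" and "norm v \<le> b"
  shows "AE y in \<mu>. \<bar>v \<bullet> \<nu> y\<bar> \<le> b"
proof -
  have "AE y in \<mu>. norm (\<nu> y) = 1" using assms by (simp add: frac_grad_polar_def)
  then show ?thesis
  proof eventually_elim
    case (elim y)
    then show ?case using Cauchy_Schwarz_ineq2[of v "\<nu> y"] assms(2) by simp
  qed
qed

context
  fixes \<alpha> :: real and f :: "'a::euclidean_space \<Rightarrow> real" and \<mu> \<nu> K and c :: 'a and r :: real
  assumes \<alpha>: "0 < \<alpha>" "\<alpha> < 1"
    and mf [measurable]: "f \<in> borel_measurable lebesgue"
    and loc: "integrable lebesgue (\<lambda>x. f x * indicator (ball c r) x)"
    and polar: "frac_grad_polar \<alpha> f \<mu> \<nu>"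
    and r: "r > 0" and K: "K \<ge> 0"
    and gag: "\<And>k. (\<integral>\<^sup>+x. ennreal \<bar>f x\<bar> * gagliardo \<alpha> (ball_cutoff c r k) x \<partial>lebesgue) \<le> ennreal K"
begin

interpretation finite_borel_measure \<mu>
  using polar by (simp add: frac_grad_polar_def finite_borel_measure_def finite_borel_measure_axioms_def)

lemma polar_field_measurable: "\<nu> \<in> borel_measurable \<mu>"
  using polar by (simp add: frac_grad_polar_def)

lemma integral_by_parts: "test_field \<phi> \<Longrightarrow>
    (\<integral>x. f x * frac_div \<alpha> \<phi> x \<partial>lebesgue) = - (\<integral>x. \<phi> x \<bullet> \<nu> x \<partial>\<mu>)"
  using polar by (simp add: frac_grad_polar_def)

lemma borel_measurable_polarI: "g \<in> borel_measurable borel \<Longrightarrow> g \<in> borel_measurable \<mu>"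
  using sets_eq by (simp cong: measurable_cong_sets)

text \<open>The cutoffs times \<open>e\<close> are test fields whose divergence is controlled by the
  potential of the cutoff. Integration by parts bounds their pairing with \<nu> independently of
  \<open>k\<close>, and the bound survives the limit.\<close>

lemma integral_ball_polar_le:
  "\<bar>\<integral>y. indicator (ball c r) y * (e \<bullet> \<nu> y) \<partial>\<mu>\<bar> \<le> \<bar>mu_const DIM('a) \<alpha>\<bar> * norm e * K"
proof -
  note [measurable] = polar_field_measurable
  have le: "\<bar>\<integral>y. ball_cutoff c r k y * (e \<bullet> \<nu> y) \<partial>\<mu>\<bar> \<le> \<bar>mu_const DIM('a) \<alpha>\<bar> * norm e * K" for k
  proof -
    have tf: "test_field (\<lambda>y. ball_cutoff c r k y *\<^sub>R e)" by (rule test_field_ball_cutoff_const[OF r])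
    have "\<bar>\<integral>x. f x * frac_div \<alpha> (\<lambda>y. ball_cutoff c r k y *\<^sub>R e) x \<partial>lebesgue\<bar> \<le> \<bar>mu_const DIM('a) \<alpha>\<bar> * norm e * K"
      by (rule weighted_integral_bound(2)[OF frac_div_cutoff_const[OF tf _ \<alpha>] _ K gag mf])
        (auto intro!: measurable_completion simp: borel_measurable_frac_div[OF test_field_measurable[OF tf]])
    then show ?thesis using integral_by_parts[OF tf] by simp
  qed
  have "(\<lambda>k. \<integral>y. ball_cutoff c r k y * (e \<bullet> \<nu> y) \<partial>\<mu>) \<longlonglongrightarrow> (\<integral>y. indicator (ball c r) y * (e \<bullet> \<nu> y) \<partial>\<mu>)"
  \<comment> \<open>The constant is integrable because \<mu> is finite. The cutoffs converge at
    every point, with limit 0 on the sphere, so mass of \<mu> on the sphere does no harm.\<close>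
  proof (rule integral_dominated_convergence[where w="\<lambda>_. norm e"])
    show "AE y in \<mu>. (\<lambda>k. ball_cutoff c r k y * (e \<bullet> \<nu> y)) \<longlonglongrightarrow> indicator (ball c r) y * (e \<bullet> \<nu> y)"
      by (intro AE_I2 tendsto_mult ball_cutoff_tendsto[OF r] tendsto_const)
    show "AE y in \<mu>. norm (ball_cutoff c r k y * (e \<bullet> \<nu> y)) \<le> norm e" for k
      using frac_grad_polar_AE_le[OF polar, of e "norm e", OF order_refl]
    proof eventually_elim
      case (elim y)
      then show ?case using ball_cutoff_bounds[of c r k y]
        mult_mono[of "ball_cutoff c r k y" 1 "\<bar>e \<bullet> \<nu> y\<bar>" "norm e"] by (simp add: abs_mult)
    qed
  qed (auto intro!: borel_measurable_times borel_measurable_inner borel_measurable_polarI polar_field_measurable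
      borel_measurable_indicator)
  then show ?thesis using le by (intro LIMSEQ_le_const2[OF tendsto_rabs]) auto
qed

text \<open>With \<eta> a cutoff and T the commutator, the integral of f \<eta> div \<phi> equals
  minus the pairing of \<eta> \<phi> with \<nu> \<mu>, at most \<mu>(B), minus the integral of f T,
  bounded by the potential. Both bounds are independent of \<open>k\<close>, and f \<eta> tends to
  the restriction of \<open>f\<close> to the ball.\<close>

lemma frac_var_ball_le:
  "frac_var \<alpha> (\<lambda>y. f y * indicator (ball c r) y) \<le> ereal (measure \<mu> (ball c r) + \<bar>mu_const DIM('a) \<alpha>\<bar> * K)"
  unfolding frac_var_def
proof (intro SUP_least, clarsimp)
  fix \<phi> :: "'a \<Rightarrow> 'a" assume \<phi>: "test_field \<phi>" and \<phi>1: "\<forall>x. norm (\<phi> x) \<le> 1"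
  note m\<phi> [measurable] = test_field_measurable[OF \<phi>]
  obtain C where C: "\<And>x. \<bar>frac_div \<alpha> \<phi> x\<bar> \<le> C" using frac_div_bounded[OF \<phi> \<alpha>] by metis
  have md [measurable]: "frac_div \<alpha> \<phi> \<in> borel_measurable lebesgue"
    by (intro measurable_completion) (simp add: borel_measurable_frac_div)
  have mc [measurable]: "ball_cutoff c r k \<in> borel_measurable lebesgue" for k
    by (intro measurable_completion) simp
  \<comment> \<open>\<open>C\<close> bounds the fractional divergence of \<phi> everywhere and the
    cutoff is below the indicator, so local integrability of \<open>f\<close> dominates all terms of
    the sequence.\<close>
  have dom: "integrable lebesgue (\<lambda>x. C * norm (f x * indicator (ball c r) x))"
    using loc by auto
  have domle: "norm (f x * ball_cutoff c r k x * frac_div \<alpha> \<phi> x) \<le> C * norm (f x * indicator (ball c r) x)" for k x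
  proof -
    have "norm (f x * ball_cutoff c r k x * frac_div \<alpha> \<phi> x) = \<bar>frac_div \<alpha> \<phi> x\<bar> * (\<bar>f x\<bar> * ball_cutoff c r k x)"
      using ball_cutoff_bounds[of c r k x] by (simp add: abs_mult)
    also have "\<dots> \<le> C * (\<bar>f x\<bar> * indicator (ball c r) x)"
      using C[of x] ball_cutoff_bounds[of c r k x] ball_cutoff_le_indicator[OF r, of c k x]
      by (intro mult_mono mult_left_mono) (auto intro: order_trans[OF abs_ge_zero])
    finally show ?thesis by (simp add: abs_mult)
  qed
  have le: "(\<integral>x. f x * ball_cutoff c r k x * frac_div \<alpha> \<phi> x \<partial>lebesgue)
      \<le> measure \<mu> (ball c r) + \<bar>mu_const DIM('a) \<alpha>\<bar> * K" for k
  proof -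
    let ?\<eta> = "ball_cutoff c r k"
    let ?\<phi> = "\<lambda>y. ?\<eta> y *\<^sub>R \<phi> y"
    have tf: "test_field ?\<phi>" by (rule test_field_cutoff[OF smooth_ball_cutoff \<phi>])
    have mdt [measurable]: "frac_div \<alpha> ?\<phi> \<in> borel_measurable lebesgue"
      by (intro measurable_completion) (simp add: borel_measurable_frac_div[OF test_field_measurable[OF tf]])
    let ?T = "\<lambda>x. frac_div \<alpha> ?\<phi> x - ?\<eta> x * frac_div \<alpha> \<phi> x"
    note T_bound = frac_div_commutator[OF \<phi> smooth_ball_cutoff \<alpha> spec[OF \<phi>1]]
    have T: "integrable lebesgue (\<lambda>x. f x * ?T x)"
      by (rule weighted_integral_bound(1)[OF T_bound _ K gag mf], simp, measurable)
    have T_le: "\<bar>\<integral>x. f x * ?T x \<partial>lebesgue\<bar> \<le> \<bar>mu_const DIM('a) \<alpha>\<bar> * 1 * K"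
      by (rule weighted_integral_bound(2)[OF T_bound _ K gag mf], simp, measurable)
    have i: "integrable lebesgue (\<lambda>x. f x * ?\<eta> x * frac_div \<alpha> \<phi> x)"
    proof (rule Bochner_Integration.integrable_bound[OF dom])
      show "AE x in lebesgue. norm (f x * ?\<eta> x * frac_div \<alpha> \<phi> x) \<le> norm (C * norm (f x * indicator (ball c r) x))"
      proof (rule AE_I2)
        fix x show "norm (f x * ?\<eta> x * frac_div \<alpha> \<phi> x) \<le> norm (C * norm (f x * indicator (ball c r) x))"
          using domle[of x k] by (metis abs_ge_self order_trans real_norm_def)
      qed
    qed measurable
    have "(\<integral>x. f x * frac_div \<alpha> ?\<phi> x \<partial>lebesgue) = (\<integral>x. f x * ?\<eta> x * frac_div \<alpha> \<phi> x + f x * ?T x \<partial>lebesgue)"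
      by (rule Bochner_Integration.integral_cong) (auto simp: algebra_simps)
    also have "\<dots> = (\<integral>x. f x * ?\<eta> x * frac_div \<alpha> \<phi> x \<partial>lebesgue) + (\<integral>x. f x * ?T x \<partial>lebesgue)"
      by (rule Bochner_Integration.integral_add[OF i T])
    finally have split: "(\<integral>x. f x * ?\<eta> x * frac_div \<alpha> \<phi> x \<partial>lebesgue)
      = - (\<integral>x. ?\<phi> x \<bullet> \<nu> x \<partial>\<mu>) - (\<integral>x. f x * ?T x \<partial>lebesgue)"
      using integral_by_parts[OF tf] by simp
    have "- (\<integral>x. ?\<phi> x \<bullet> \<nu> x \<partial>\<mu>) \<le> measure \<mu> (ball c r)"
    proof -
      have "\<bar>\<integral>x. ?\<phi> x \<bullet> \<nu> x \<partial>\<mu>\<bar> \<le> (\<integral>x. \<bar>?\<phi> x \<bullet> \<nu> x\<bar> \<partial>\<mu>)" by (rule integral_abs_bound)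
      also have "\<dots> \<le> (\<integral>x. indicator (ball c r) x \<partial>\<mu>)"
      proof (rule integral_mono_AE')
        have "AE y in \<mu>. norm (\<nu> y) = 1" using polar by (simp add: frac_grad_polar_def)
        then show "AE x in \<mu>. \<bar>?\<phi> x \<bullet> \<nu> x\<bar> \<le> indicator (ball c r) x"
        proof eventually_elim
          case (elim x)
          have "\<bar>?\<phi> x \<bullet> \<nu> x\<bar> \<le> norm (?\<phi> x)" using Cauchy_Schwarz_ineq2[of "?\<phi> x" "\<nu> x"] elim by simp
          also have "\<dots> = ?\<eta> x * norm (\<phi> x)" using ball_cutoff_bounds(1)[of c r k x] by simp
          also have "\<dots> \<le> ?\<eta> x * 1" using \<phi>1 ball_cutoff_bounds(1)[of c r k x] by (intro mult_left_mono) auto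
          also have "\<dots> \<le> indicator (ball c r) x" using ball_cutoff_le_indicator[OF r] by simp
          finally show ?case .
        qed
      qed (auto simp: sets_eq emeasure_eq_measure)
      also have "\<dots> = measure \<mu> (ball c r)" by simp
      finally show ?thesis by linarith
    qed
    then show ?thesis using split T_le by linarith
  qed
  have "(\<lambda>k. \<integral>x. f x * ball_cutoff c r k x * frac_div \<alpha> \<phi> x \<partial>lebesgue)
     \<longlonglongrightarrow> (\<integral>x. f x * indicator (ball c r) x * frac_div \<alpha> \<phi> x \<partial>lebesgue)"
  proof (rule integral_dominated_convergence[OF _ _ dom])
    show "(\<lambda>x. f x * indicator (ball c r) x * frac_div \<alpha> \<phi> x) \<in> borel_measurable lebesgue"
      by (intro borel_measurable_times borel_measurable_indicator mf md) auto
    show "(\<lambda>x. f x * ball_cutoff c r k x * frac_div \<alpha> \<phi> x) \<in> borel_measurable lebesgue" for k by measurable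
    show "AE x in lebesgue. (\<lambda>k. f x * ball_cutoff c r k x * frac_div \<alpha> \<phi> x)
        \<longlonglongrightarrow> f x * indicator (ball c r) x * frac_div \<alpha> \<phi> x"
      by (intro AE_I2 tendsto_mult ball_cutoff_tendsto[OF r] tendsto_const)
    show "AE x in lebesgue. norm (f x * ball_cutoff c r k x * frac_div \<alpha> \<phi> x) \<le> C * norm (f x * indicator (ball c r) x)" for k
      by (intro AE_I2 domle)
  qed
  then show "(\<integral>x. f x * indicator (ball c r) x * frac_div \<alpha> \<phi> x \<partial>lebesgue)
      \<le> measure \<mu> (ball c r) + \<bar>mu_const DIM('a) \<alpha>\<bar> * K"
    using le by (intro LIMSEQ_le_const2) auto
qed

end

section \<open>Choice of the constants and conclusion\<close>

theorem theorem4p3: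
  fixes \<alpha> :: real and p :: ereal and q :: real
  assumes "0 < \<alpha>" "\<alpha> < 1"
    and "ereal (1 / (1 - \<alpha>)) < p"
    and "1 \<le> q" and "1 / p + ereal (1 / q) = 1"
  shows "\<exists>A B :: real. A > 0 \<and> B > 0 \<and>
    (\<forall>(f :: 'a::euclidean_space \<Rightarrow> real) \<mu> \<nu>.
       BV_frac \<alpha> p f \<longrightarrow> frac_grad_polar \<alpha> f \<mu> \<nu> \<longrightarrow>
       (AE x in \<mu>. \<exists>rx > 0. \<forall>r. 0 < r \<and> r < rx \<longrightarrow>
          emeasure \<mu> (ball x r) \<le> ennreal (A * Lp_norm p f * r powr (real DIM('a) / q - \<alpha>)) \<and>
          frac_var \<alpha> (\<lambda>y. f y * indicator (ball x r) y)
            \<le> ereal (B * Lp_norm p f * r powr (real DIM('a) / q - \<alpha>))))"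
proof -
  define n where "n = real DIM('a)"
  define s where "s = n / q - \<alpha>"
  have n: "n \<ge> 1" using DIM_positive[where 'a='a] by (simp add: n_def Suc_leI)
  have "1 \<le> 1 / (1 - \<alpha>)" using assms(1,2) by (simp add: field_simps)
  then have "1 \<le> ereal (1 / (1 - \<alpha>))" by simp
  then have p1: "1 < p" using assms(3) by (rule le_less_trans)
  \<comment> \<open>Equivalent to \<alpha> < 1/q = 1 - 1/p, which is the lower bound on p rewritten;
    at p infinite, q = 1.\<close>
  have \<alpha>q: "\<alpha> * q < 1"
  proof (cases p)
    case (real t)
    have "t > 1 / (1 - \<alpha>)" using assms(3) real by simp
    moreover have "1 / (1 - \<alpha>) > 0" using assms(2) by simp
    moreover from calculation have "t > 0" by linarith
    ultimately have "1 / t < 1 / (1 / (1 - \<alpha>))"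
      by (intro divide_strict_left_mono mult_pos_pos) auto
    then have "1 / t < 1 - \<alpha>" by simp
    moreover have "1 / t + 1 / q = 1" using assms(5) real p1 by (simp add: one_ereal_def)
    ultimately have "\<alpha> < 1 / q" by linarith
    then show ?thesis using assms(4) by (simp add: field_simps)
  next
    case PInf
    then have "q = 1" using assms(5) by (simp add: one_ereal_def)
    then show ?thesis using assms by simp
  qed (use p1 in auto)
  \<comment> \<open>Makes the bound monotone in the radius, so that superlevel balls of a cutoff
    inherit the bound of the full ball.\<close>
  have s0: "s \<ge> 0"
  proof -
    have "\<alpha> * q \<le> n" using \<alpha>q n by simp
    then show ?thesis using assms(4) by (simp add: s_def field_simps)
  qed
  have "n / q \<le> n" using assms(4) n by (simp add: field_simps)
  then have s2: "s \<le> 2 * n" using assms(1) n by (simp add: s_def)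
  obtain C where C: "C > 0" "\<And>f t (c :: 'a). in_Lp p f \<Longrightarrow> t \<ge> 0 \<Longrightarrow>
     (\<integral>\<^sup>+x. ennreal \<bar>f x\<bar> * gagliardo \<alpha> (indicator (ball c t)) x \<partial>lebesgue) \<le> ennreal (C * Lp_norm p f * t powr s)"
    using gagliardo_ball_weighted[OF assms(1,4) \<alpha>q p1 assms(5), where 'a='a] unfolding s_def n_def by metis
  define m where "m = \<bar>mu_const DIM('a) \<alpha>\<bar>"
  have m: "m \<ge> 0" by (simp add: m_def)
  \<comment> \<open>One factor 2 bounds the norm of the reference vectors, the other comes from the
    growth lemma; the summand 1 secures positivity without a sign for \<open>m\<close>. The
    commutator adds m C to \<open>B\<close>. Both are fixed before \<open>f\<close> is
    introduced.\<close>
  define A where "A = 4 * m * C + 1"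
  define B where "B = A + m * C"
  have AB: "A > 0" "B > 0" using m C(1) by (auto simp: A_def B_def add_nonneg_pos add_pos_nonneg)
  have "AE x in \<mu>. \<exists>rx>0. \<forall>r. 0 < r \<and> r < rx \<longrightarrow>
          emeasure \<mu> (ball x r) \<le> ennreal (A * Lp_norm p f * r powr s) \<and>
          frac_var \<alpha> (\<lambda>y. f y * indicator (ball x r) y) \<le> ereal (B * Lp_norm p f * r powr s)"
    if f: "BV_frac \<alpha> p f" and polar: "frac_grad_polar \<alpha> f \<mu> \<nu>" for f :: "'a \<Rightarrow> real" and \<mu> \<nu>
  proof -
    define M where "M = Lp_norm p f"
    have M: "M \<ge> 0" by (simp add: M_def Lp_norm_nonneg)
    have Lp: "in_Lp p f" using f by (simp add: BV_frac_def)
    have mf: "f \<in> borel_measurable lebesgue" using Lp by (simp add: in_Lp_def)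
    interpret finite_borel_measure \<mu>
      using polar by (simp add: frac_grad_polar_def finite_borel_measure_def finite_borel_measure_axioms_def)
    have loc: "integrable lebesgue (\<lambda>x. f x * indicator (ball c r) x)" for c r
      using p1 by (intro in_Lp_locally_integrable[OF Lp]) auto
    have K: "C * M * r powr s \<ge> 0" for r using C(1) M by simp
    have gag: "(\<integral>\<^sup>+x. ennreal \<bar>f x\<bar> * gagliardo \<alpha> (ball_cutoff c r k) x \<partial>lebesgue) \<le> ennreal (C * M * r powr s)"
      if r: "r > 0" for c r k
    proof (rule gagliardo_cutoff_weighted[OF mf])
      fix t :: real assume t: "0 \<le> t" "t < 1"
      obtain u where u: "0 \<le> u" "u \<le> r" "{y. t < ball_cutoff c r k y} = ball c u"
        using ball_cutoff_superlevel[OF r t] by metis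
      have "C * M * u powr s \<le> C * M * r powr s"
        using u s0 C(1) M by (intro mult_left_mono powr_mono2) auto
      then show "(\<integral>\<^sup>+x. ennreal \<bar>f x\<bar> * gagliardo \<alpha> (indicator {y. t < ball_cutoff c r k y}) x \<partial>lebesgue)
         \<le> ennreal (C * M * r powr s)"
        unfolding u(3) using C(2)[OF Lp u(1), of c] by (auto simp: M_def intro: order_trans ennreal_leI)
    qed (auto simp: ball_cutoff_bounds)
    have upper: "AE x in \<mu>. \<exists>rx>0. \<forall>r. 0 < r \<and> r < rx \<longrightarrow> measure \<mu> (ball x r) \<le> 2 * (2 * m * C * M) * r powr s"
    proof (rule AE_upper_growth[of \<nu>])
      show "\<nu> \<in> borel_measurable \<mu>" "AE x in \<mu>. norm (\<nu> x) = 1" using polar by (auto simp: frac_grad_polar_def)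
      show "0 \<le> 2 * m * C * M" using m C(1) M by simp
      show "s \<le> 2 * real DIM('a)" using s2 by (simp add: n_def)
      fix x e :: 'a and r :: real assume r: "r > 0" and e: "norm e \<le> 2"
      have "\<bar>\<integral>y. indicator (ball x r) y * (e \<bullet> \<nu> y) \<partial>\<mu>\<bar> \<le> m * norm e * (C * M * r powr s)"
        unfolding m_def by (rule integral_ball_polar_le[OF assms(1,2) mf loc polar r K gag[OF r]])
      also have "\<dots> \<le> m * 2 * (C * M * r powr s)"
        using e m K by (intro mult_right_mono mult_left_mono) auto
      finally show "(\<integral>y. indicator (ball x r) y * (e \<bullet> \<nu> y) \<partial>\<mu>) \<le> 2 * m * C * M * r powr s"
        by (simp add: mult_ac)
    qed
    then show ?thesis
    proof eventually_elim
      case (elim x)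
      then obtain rx where rx: "rx > 0"
        "\<And>r. 0 < r \<Longrightarrow> r < rx \<Longrightarrow> measure \<mu> (ball x r) \<le> 2 * (2 * m * C * M) * r powr s" by blast
      have "emeasure \<mu> (ball x r) \<le> ennreal (A * M * r powr s) \<and>
          frac_var \<alpha> (\<lambda>y. f y * indicator (ball x r) y) \<le> ereal (B * M * r powr s)"
        if r: "0 < r" "r < rx" for r
      proof -
        have "2 * (2 * m * C * M) * r powr s \<le> A * M * r powr s"
          using M by (intro mult_right_mono) (auto simp: A_def algebra_simps)
        with rx(2)[OF r] have 1: "measure \<mu> (ball x r) \<le> A * M * r powr s" by linarith
        have "frac_var \<alpha> (\<lambda>y. f y * indicator (ball x r) y) \<le> ereal (measure \<mu> (ball x r) + m * (C * M * r powr s))"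
          unfolding m_def by (rule frac_var_ball_le[OF assms(1,2) mf loc polar r(1) K gag[OF r(1)]])
        also have "\<dots> \<le> ereal (B * M * r powr s)"
          using 1 by (simp add: B_def algebra_simps)
        finally show ?thesis using 1 by (simp add: emeasure_eq_measure ennreal_leI)
      qed
      then show ?case using rx(1) by (auto simp: M_def)
    qed
  qed
  then show ?thesis using AB unfolding s_def n_def by blast
qed

end
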